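(* Let $V$ be a finite-dimensional real vector space, $\Sigma\subset\mathbb{Z}^N$ simply connected, and $f:\Sigma\to G_2(V)$ a map into the Grassmannian of $2$-planes in $V$. Then the following are equivalent: (1) $f$ is a regular applicable line congruence (via some $1$-form $\eta$); (2) $f$ is regular and is spanned by a Koenigs–Moutard pair of Koenigs nets $(s^{\pm},\eta^{\pm})$ with $s^{\pm}<f$, that is, $f=s^+\oplus s^-$. In this case $[\eta]=[\eta^+]=[\eta^-]$ (for $(f,\eta)$ as in (1), the pair in (2) can be taken with $\eta^\pm\in[\eta]$; for a pair as in (2), $f$ is applicable via any $\eta\in[\eta^+]=[\eta^-]$).
   Context: Domain: an edge $ij$ of $\Sigma\subset\mathbb{Z}^N$ is a pair of points of $\Sigma$ differing by a standard unit vector; a quadrilateral is an elementary square with all four vertices $i,j,k,\ell$ (in cyclic order) in $\Sigma$. $\Sigma$ is simply connected if any two points are joined by an edge-path in $\Sigma$ and any two edge-paths in $\Sigma$ with the same end-points are related by finitely many moves: (a) replace $i$ by $(iji)$ or conversely, $ij$ an edge; (b) replace $(k\ell i)$ by $(kji)$ on a quadrilateral. A $1$-form $\alpha$ with values in a vector space assigns $\alpha_{ji}=-\alpha_{ij}$ to each oriented edge from $i$ to $j$; it is closed if $\alpha_{i\ell}+\alpha_{\ell k}+\alpha_{kj}+\alpha_{ji}=0$ on every quadrilateral. For a function $\tau$, $\mathrm{d}\tau_{ji}=\tau_j-\tau_i$. $\Gamma$ denotes sections of a bundle (families of fibre elements indexed by $\Sigma$). Koenigs nets. A map $s$ from such a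 domain to $\mathbb{P}(V)$ (a line subbundle) is regular if on each quadrilateral $s_i,s_j,s_k,s_\ell$ are pairwise distinct and $\dim(s_i+s_j+s_k+s_\ell)\ge3$. A Koenigs net $(s,\eta)$ is a regular $s$ with a closed, never-zero $\Lambda^2V$-valued $1$-form $\eta$ such that $\eta_{ji}\in s_j\wedge s_i$ on each edge. Koenigs–Moutard pair. For Koenigs nets $(s^\pm,\eta^\pm)$ on $\Sigma$ let $s=s^+\sqcup s^-:\{0,1\}\times\Sigma\to\mathbb{P}(V)$ be $s^+$ on $\{0\}\times\Sigma$ and $s^-$ on $\{1\}\times\Sigma$, where $\{0,1\}\times\Sigma\subset\mathbb{Z}^{N+1}$. The nets form a Koenigs–Moutard pair if $s$ is regular (including on the vertical quadrilaterals) and there is a $1$-form $\eta$ on $\{0,1\}\times\Sigma$, restricting to $\eta^+$ on $\{0\}\times\Sigma$ and $\eta^-$ on $\{1\}\times\Sigma$, such that $(s,\eta)$ is a Koenigs net. Line congruences. $f:\Sigma\to G_2(V)$ is a line congruence if $f_i\cap f_j\ne\{0\}$ on each edge. It is regular if (i) on each edge $f_{ij}:=f_i+f_j$ is $3$-dimensional, so that $s_{ij}:=f_i\cap f_j$ is $1$-dimensional, and (ii) on each quadrilateral $s_{ij}\wedge s_{jk}\wedge s_{k\ell}\wedge s_{\ell i}\ne\{0\}$. A regular line congruence $f$ is applicable (via $\eta$) if there is a closed $\Lambda^2V$-valued $1$-form $\eta$ with, on each edge, $\eta_{ij}\in\Lambda^2f_{ij}$ and $\eta_{ij}\wedge s_{ij}\ne\{0\}$.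 Then also $\eta+\mathrm{d}\tau$ has these properties for any $\tau\in\Gamma\Lambda^2f$, and $[\eta]:=\{\eta+\mathrm{d}\tau:\tau\in\Gamma\Lambda^2f\}$. *)

theory Defs
  imports "HOL-Analysis.Finite_Cartesian_Product" "HOL-Library.Poly_Mapping"
begin

section \<open>The exterior algebra of a real vector space\<close>

text \<open>The exterior algebra is the free associative real algebra on the set of vectors (monoid
  algebra of words), modulo the two-sided ideal generated by the linearity relations and by all
  squares \<open>v v\<close>; equivalently, the tensor algebra modulo all \<open>v \<otimes> v\<close>.\<close>

datatype 'v word = Word "'v list"

instantiation word :: (type) monoid_add
begin

definition zero_word :: "'v word" where
  "zero_word = Word []"

fun plus_word :: "'v word \<Rightarrow> 'v word \<Rightarrow> 'v word" where
  "plus_word (Word xs) (Word ys) = Word (xs @ ys)"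

instance
proof
  fix a b c :: "'v word"
  show "a + b + c = a + (b + c)" by (cases a; cases b; cases c) simp
  show "0 + a = a" by (cases a) (simp add: zero_word_def)
  show "a + 0 = a" by (cases a) (simp add: zero_word_def)
qed

end

type_synonym 'v free_alg = "'v word \<Rightarrow>\<^sub>0 real"

abbreviation gen :: "'v \<Rightarrow> 'v free_alg" where
  "gen v \<equiv> Poly_Mapping.single (Word [v]) 1"

abbreviation scalar :: "real \<Rightarrow> 'v free_alg" where
  "scalar c \<equiv> Poly_Mapping.single 0 c"

inductive_set ext_ideal :: "'v::real_vector free_alg set" where
  rel_add: "gen (u + v) - (gen u + gen v) \<in> ext_ideal"
| rel_scale: "gen (c *\<^sub>R v) - scalar c * gen v \<in> ext_ideal"
| rel_square: "gen v * gen v \<in> ext_ideal"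
| zero: "0 \<in> ext_ideal"
| add: "x \<in> ext_ideal \<Longrightarrow> y \<in> ext_ideal \<Longrightarrow> x + y \<in> ext_ideal"
| mult: "x \<in> ext_ideal \<Longrightarrow> p * x * q \<in> ext_ideal"

lemma ext_ideal_mult_left: "x \<in> ext_ideal \<Longrightarrow> p * x \<in> ext_ideal"
  using ext_ideal.mult[of x p 1] by simp

lemma ext_ideal_mult_right: "x \<in> ext_ideal \<Longrightarrow> x * q \<in> ext_ideal"
  using ext_ideal.mult[of x 1 q] by simp

lemma ext_ideal_uminus: "x \<in> ext_ideal \<Longrightarrow> - x \<in> ext_ideal"
  using ext_ideal_mult_left[of x "- 1"] by simp

lemma ext_ideal_diff: "x \<in> ext_ideal \<Longrightarrow> y \<in> ext_ideal \<Longrightarrow> x - y \<in> ext_ideal"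
  using ext_ideal.add[of x "- y"] ext_ideal_uminus[of y] by simp

lemma scalar_commute: "p * scalar c = scalar c * (p :: 'v free_alg)"
proof (induction p rule: update_induct)
  case const
  show ?case by simp
next
  case (update f a b)
  have "Poly_Mapping.update a b f = f + Poly_Mapping.single a b"
    using update(1) by (intro poly_mapping_eqI)
      (auto simp: lookup_update lookup_add lookup_single not_in_keys_iff_lookup_eq_zero when_def)
  then show ?case
    using update by (simp add: distrib_left distrib_right mult_single mult.commute)
qed

quotient_type (overloaded) 'v exterior =
  "'v::real_vector free_alg" / "\<lambda>x y. x - y \<in> ext_ideal"
proof (intro equivpI reflpI sympI transpI)
  fix x y z :: "'v free_alg"
  show "x - x \<in> ext_ideal" by (simp add: ext_ideal.zero)
  show "y - x \<in> ext_ideal" if "x - y \<in> ext_ideal" using ext_ideal_uminus[OF that] by simp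
  show "x - z \<in> ext_ideal" if "x - y \<in> ext_ideal" "y - z \<in> ext_ideal"
    using ext_ideal.add[OF that] by simp
qed

instantiation exterior :: (real_vector) real_algebra
begin

lift_definition zero_exterior :: "'a exterior" is 0 .

lift_definition plus_exterior :: "'a exterior \<Rightarrow> 'a exterior \<Rightarrow> 'a exterior" is "(+)"
  by (metis add_diff_add ext_ideal.add)

lift_definition uminus_exterior :: "'a exterior \<Rightarrow> 'a exterior" is uminus
  by (metis ext_ideal_uminus minus_diff_minus)

lift_definition minus_exterior :: "'a exterior \<Rightarrow> 'a exterior \<Rightarrow> 'a exterior" is "(-)"
proof -
  fix x x' y y' :: "'a free_alg"
  assume "x - x' \<in> ext_ideal" "y - y' \<in> ext_ideal"
  moreover have "(x - y) - (x' - y') = (x - x') - (y - y')" by simp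
  ultimately show "(x - y) - (x' - y') \<in> ext_ideal" by (metis ext_ideal_diff)
qed

lift_definition times_exterior :: "'a exterior \<Rightarrow> 'a exterior \<Rightarrow> 'a exterior" is "(*)"
proof -
  fix x x' y y' :: "'a free_alg"
  assume "x - x' \<in> ext_ideal" "y - y' \<in> ext_ideal"
  then have "(x - x') * y + x' * (y - y') \<in> ext_ideal"
    by (intro ext_ideal.add ext_ideal_mult_left ext_ideal_mult_right)
  then show "x * y - x' * y' \<in> ext_ideal" by (simp add: algebra_simps)
qed

lift_definition scaleR_exterior :: "real \<Rightarrow> 'a exterior \<Rightarrow> 'a exterior" is "\<lambda>c x. scalar c * x"
  by (metis ext_ideal_mult_left right_diff_distrib)

instance
proof
  note [simp] = ext_ideal.zero
  fix a b c :: "'a exterior" and r s :: real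
  show "a + b + c = a + (b + c)" by transfer (simp add: add.assoc)
  show "a + b = b + a" by transfer (simp add: add.commute)
  show "0 + a = a" by transfer simp
  show "- a + a = 0" by transfer simp
  show "a - b = a + - b" by transfer simp
  show "a * b * c = a * (b * c)" by transfer (simp add: mult.assoc)
  show "(a + b) * c = a * c + b * c" by transfer (simp add: distrib_right)
  show "a * (b + c) = a * b + a * c" by transfer (simp add: distrib_left)
  show "r *\<^sub>R (a + b) = r *\<^sub>R a + r *\<^sub>R b" by transfer (simp add: distrib_left)
  show "(r + s) *\<^sub>R a = r *\<^sub>R a + s *\<^sub>R a" by transfer (simp add: single_add distrib_right)
  show "r *\<^sub>R s *\<^sub>R a = (r * s) *\<^sub>R a"
    by transfer (simp add: mult.assoc[symmetric] mult_single)
  show "1 *\<^sub>R a = a" by transfer simp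
  show "r *\<^sub>R a * b = r *\<^sub>R (a * b)" by transfer (simp add: mult.assoc)
  show "a * r *\<^sub>R b = r *\<^sub>R (a * b)"
  proof transfer
    fix x y :: "'a free_alg" and r
    have "x * (scalar r * y) = scalar r * (x * y)"
      by (metis mult.assoc scalar_commute)
    then show "x * (scalar r * y) - scalar r * (x * y) \<in> ext_ideal" by simp
  qed
qed

end

lift_definition ext_of :: "'v::real_vector \<Rightarrow> 'v exterior" is gen .

lemma linear_ext_of: "linear (ext_of :: 'v::real_vector \<Rightarrow> 'v exterior)"
proof (rule linearI)
  fix u v :: 'v and c :: real
  show "ext_of (u + v) = ext_of u + ext_of v" by transfer (rule ext_ideal.rel_add)
  show "ext_of (c *\<^sub>R v) = c *\<^sub>R ext_of v" by transfer (rule ext_ideal.rel_scale)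
qed

lemma ext_of_square: "ext_of v * ext_of v = 0"
  by transfer (simp add: ext_ideal.rel_square)

text \<open>The wedge product of two subspaces of the exterior algebra, itself a subspace.\<close>

definition wedge :: "'v::real_vector exterior set \<Rightarrow> 'v exterior set \<Rightarrow> 'v exterior set"
    (infixl "\<and>\<^sub>s" 70) where
  "A \<and>\<^sub>s B = span {a * b | a b. a \<in> A \<and> b \<in> B}"

abbreviation ext_sub :: "'v::real_vector set \<Rightarrow> 'v exterior set" where
  "ext_sub U \<equiv> ext_of ` U"

definition Lambda2 :: "'v::real_vector set \<Rightarrow> 'v exterior set" where
  "Lambda2 U = ext_sub U \<and>\<^sub>s ext_sub U"


section \<open>Domains in the integer lattice\<close>

definition edge :: "(int^'n) set \<Rightarrow> int^'n \<Rightarrow> int^'n \<Rightarrow> bool" where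
  "edge S i j \<longleftrightarrow> i \<in> S \<and> j \<in> S \<and> (\<exists>m. j = i + axis m 1 \<or> i = j + axis m 1)"

text \<open>The vertices are listed in cyclic order, with any starting vertex and orientation.\<close>

definition quad :: "(int^'n) set \<Rightarrow> int^'n \<Rightarrow> int^'n \<Rightarrow> int^'n \<Rightarrow> int^'n \<Rightarrow> bool" where
  "quad S i j k l \<longleftrightarrow> i \<in> S \<and> j \<in> S \<and> k \<in> S \<and> l \<in> S \<and>
     (\<exists>a b u v. a \<noteq> b \<and> u \<in> {axis a 1, - axis a 1} \<and> v \<in> {axis b 1, - axis b 1} \<and>
        j = i + u \<and> k = i + u + v \<and> l = i + v)"

definition edge_path :: "(int^'n) set \<Rightarrow> (int^'n) list \<Rightarrow> bool" where
  "edge_path S p \<longleftrightarrow> p \<noteq> [] \<and> set p \<subseteq> S \<and> successively (edge S) p"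

inductive path_move :: "(int^'n) set \<Rightarrow> (int^'n) list \<Rightarrow> (int^'n) list \<Rightarrow> bool" for S where
  spur: "edge S i j \<Longrightarrow> path_move S (p @ [i] @ q) (p @ [i, j, i] @ q)"
| flip: "quad S i j k l \<Longrightarrow> path_move S (p @ [k, l, i] @ q) (p @ [k, j, i] @ q)"

definition simply_connected_domain :: "(int^'n) set \<Rightarrow> bool" where
  "simply_connected_domain S \<longleftrightarrow>
     (\<forall>i\<in>S. \<forall>j\<in>S. \<exists>p. edge_path S p \<and> hd p = i \<and> last p = j) \<and>
     (\<forall>p q. edge_path S p \<and> edge_path S q \<and> hd p = hd q \<and> last p = last q
        \<longrightarrow> equivclp (path_move S) p q)"


section \<open>One-forms\<close>

text \<open>\<open>\<alpha> j i\<close> is the value on the oriented edge from \<open>i\<close> to \<open>j\<close>. Values of forms (and of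
  sections) outside the domain are irrelevant.\<close>

definition one_form ::
    "(int^'n) set \<Rightarrow> 'w::real_vector set \<Rightarrow> (int^'n \<Rightarrow> int^'n \<Rightarrow> 'w) \<Rightarrow> bool" where
  "one_form S W \<alpha> \<longleftrightarrow> (\<forall>i j. edge S i j \<longrightarrow> \<alpha> j i \<in> W \<and> \<alpha> j i = - \<alpha> i j)"

definition closed_form ::
    "(int^'n) set \<Rightarrow> (int^'n \<Rightarrow> int^'n \<Rightarrow> 'w::real_vector) \<Rightarrow> bool" where
  "closed_form S \<alpha> \<longleftrightarrow> (\<forall>i j k l. quad S i j k l \<longrightarrow> \<alpha> i l + \<alpha> l k + \<alpha> k j + \<alpha> j i = 0)"

definition diff_form :: "(int^'n \<Rightarrow> 'w::real_vector) \<Rightarrow> int^'n \<Rightarrow> int^'n \<Rightarrow> 'w" where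
  "diff_form \<tau> j i = \<tau> j - \<tau> i"

text \<open>The class \<open>[\<eta>] = {\<eta> + d\<tau> | \<tau> \<in> \<Gamma> \<Lambda>\<^sup>2 f}\<close>; forms are compared on edges only, so the set
  contains all (irrelevant) extensions off the edges.\<close>

definition form_class :: "(int^'n) set \<Rightarrow> (int^'n \<Rightarrow> 'v::real_vector set) \<Rightarrow>
    (int^'n \<Rightarrow> int^'n \<Rightarrow> 'v exterior) \<Rightarrow> (int^'n \<Rightarrow> int^'n \<Rightarrow> 'v exterior) set" where
  "form_class S f \<eta> = {\<omega>. \<exists>\<tau>. (\<forall>i\<in>S. \<tau> i \<in> Lambda2 (f i)) \<and>
     (\<forall>i j. edge S i j \<longrightarrow> \<omega> j i = \<eta> j i + diff_form \<tau> j i)}"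


section \<open>Koenigs nets and Koenigs--Moutard pairs\<close>

definition Grassmannian :: "nat \<Rightarrow> 'v::real_vector set set" where
  "Grassmannian k = {U. subspace U \<and> dim U = k}"

text \<open>The projective space is \<open>Grassmannian 1\<close>, and sums of subspaces are written as spans of
  unions.\<close>

definition regular_map :: "(int^'n) set \<Rightarrow> (int^'n \<Rightarrow> 'v::real_vector set) \<Rightarrow> bool" where
  "regular_map S s \<longleftrightarrow> (\<forall>i\<in>S. s i \<in> Grassmannian 1) \<and>
     (\<forall>i j k l. quad S i j k l \<longrightarrow>
        distinct [s i, s j, s k, s l] \<and> dim (span (s i \<union> s j \<union> s k \<union> s l)) \<ge> 3)"

definition koenigs_net :: "(int^'n) set \<Rightarrow> (int^'n \<Rightarrow> 'v::real_vector set) \<Rightarrow>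
    (int^'n \<Rightarrow> int^'n \<Rightarrow> 'v exterior) \<Rightarrow> bool" where
  "koenigs_net S s \<eta> \<longleftrightarrow> regular_map S s \<and>
     one_form S (Lambda2 UNIV) \<eta> \<and> closed_form S \<eta> \<and>
     (\<forall>i j. edge S i j \<longrightarrow> \<eta> j i \<noteq> 0 \<and> \<eta> j i \<in> ext_sub (s j) \<and>\<^sub>s ext_sub (s i))"

text \<open>\<open>{0,1} \<times> S\<close> as a subset of the lattice of rank one higher: the index \<open>None\<close> is the
  additional coordinate.\<close>

definition lift_pt :: "int \<Rightarrow> int^'n \<Rightarrow> int^('n option)" where
  "lift_pt e x = (\<chi> m. case m of None \<Rightarrow> e | Some m' \<Rightarrow> x $ m')"

definition base_pt :: "int^('n option) \<Rightarrow> int^'n" where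
  "base_pt y = (\<chi> m. y $ Some m)"

definition double :: "(int^'n) set \<Rightarrow> (int^('n option)) set" where
  "double S = lift_pt 0 ` S \<union> lift_pt 1 ` S"

definition join_maps :: "(int^'n \<Rightarrow> 'a) \<Rightarrow> (int^'n \<Rightarrow> 'a) \<Rightarrow> int^('n option) \<Rightarrow> 'a" where
  "join_maps sp sm y = (if y $ None = 0 then sp (base_pt y) else sm (base_pt y))"

definition koenigs_moutard_pair :: "(int^'n) set \<Rightarrow>
    (int^'n \<Rightarrow> 'v::real_vector set) \<Rightarrow> (int^'n \<Rightarrow> int^'n \<Rightarrow> 'v exterior) \<Rightarrow>
    (int^'n \<Rightarrow> 'v set) \<Rightarrow> (int^'n \<Rightarrow> int^'n \<Rightarrow> 'v exterior) \<Rightarrow> bool" where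
  "koenigs_moutard_pair S sp \<eta>p sm \<eta>m \<longleftrightarrow>
     koenigs_net S sp \<eta>p \<and> koenigs_net S sm \<eta>m \<and>
     regular_map (double S) (join_maps sp sm) \<and>
     (\<exists>\<eta>. (\<forall>i j. edge S i j \<longrightarrow> \<eta> (lift_pt 0 j) (lift_pt 0 i) = \<eta>p j i \<and>
                             \<eta> (lift_pt 1 j) (lift_pt 1 i) = \<eta>m j i) \<and>
          koenigs_net (double S) (join_maps sp sm) \<eta>)"


section \<open>Line congruences\<close>

definition line_congruence :: "(int^'n) set \<Rightarrow> (int^'n \<Rightarrow> 'v::real_vector set) \<Rightarrow> bool" where
  "line_congruence S f \<longleftrightarrow> (\<forall>i\<in>S. f i \<in> Grassmannian 2) \<and>
     (\<forall>i j. edge S i j \<longrightarrow> f i \<inter> f j \<noteq> {0})"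

definition regular_line_congruence ::
    "(int^'n) set \<Rightarrow> (int^'n \<Rightarrow> 'v::real_vector set) \<Rightarrow> bool" where
  "regular_line_congruence S f \<longleftrightarrow> line_congruence S f \<and>
     (\<forall>i j. edge S i j \<longrightarrow> dim (span (f i \<union> f j)) = 3) \<and>
     (\<forall>i j k l. quad S i j k l \<longrightarrow>
        ext_sub (f i \<inter> f j) \<and>\<^sub>s ext_sub (f j \<inter> f k) \<and>\<^sub>s
        ext_sub (f k \<inter> f l) \<and>\<^sub>s ext_sub (f l \<inter> f i) \<noteq> {0})"

definition applicable_via :: "(int^'n) set \<Rightarrow> (int^'n \<Rightarrow> 'v::real_vector set) \<Rightarrow>
    (int^'n \<Rightarrow> int^'n \<Rightarrow> 'v exterior) \<Rightarrow> bool" where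
  "applicable_via S f \<eta> \<longleftrightarrow> regular_line_congruence S f \<and>
     one_form S (Lambda2 UNIV) \<eta> \<and> closed_form S \<eta> \<and>
     (\<forall>i j. edge S i j \<longrightarrow> \<eta> i j \<in> Lambda2 (span (f i \<union> f j)) \<and>
        {\<eta> i j} \<and>\<^sub>s ext_sub (f i \<inter> f j) \<noteq> {0})"

definition spanned_by :: "(int^'n) set \<Rightarrow> (int^'n \<Rightarrow> 'v::real_vector set) \<Rightarrow>
    (int^'n \<Rightarrow> 'v set) \<Rightarrow> (int^'n \<Rightarrow> 'v set) \<Rightarrow> bool" where
  "spanned_by S f sp sm \<longleftrightarrow> (\<forall>i\<in>S. sp i \<subseteq> f i \<and> sm i \<subseteq> f i \<and>
     sp i \<inter> sm i = {0} \<and> span (sp i \<union> sm i) = f i)"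

end

theory Submission
  imports Defs "HOL-Analysis.Continuum_Not_Denumerable"
begin

text \<open>Write \<open>s\<^sub>i\<^sub>j = f\<^sub>i \<inter> f\<^sub>j\<close>. Let \<open>f\<close> be applicable via \<open>\<eta>\<close>. A line \<open>s\<^sub>i \<subseteq> f\<^sub>i\<close> and a potential
  \<open>\<tau>\<^sub>i \<in> \<Lambda>\<^sup>2 f\<^sub>i\<close> at every vertex give a Koenigs net \<open>(s, \<eta> + d\<tau>)\<close> exactly if on every edge \<open>\<eta> + d\<tau>\<close> is
  killed by both lines. Since \<open>s\<^sub>i \<and> \<tau>\<^sub>i = 0\<close>, this says \<open>s\<^sub>i \<and> (\<eta>\<^sub>j\<^sub>i + \<tau>\<^sub>j) = 0\<close> and
  \<open>s\<^sub>j \<and> (\<eta>\<^sub>i\<^sub>j + \<tau>\<^sub>i) = 0\<close>. The first condition relates only \<open>s\<^sub>i\<close> to \<open>\<tau>\<^sub>j\<close>. Written homogeneously, as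
  \<open>x \<and> (t \<eta>\<^sub>j\<^sub>i + \<omega>) = 0\<close> for \<open>x \<in> f\<^sub>i\<close> and \<open>(t, \<omega>) \<in> \<real> \<oplus> \<Lambda>\<^sup>2 f\<^sub>j\<close>, it is a bilinear pairing of two planes
  with values in the line \<open>\<Lambda>\<^sup>3 (f\<^sub>i + f\<^sub>j)\<close>, and it is nondegenerate because \<open>\<eta>\<^sub>j\<^sub>i \<and> s\<^sub>i\<^sub>j \<noteq> 0\<close>. Hence it
  identifies the projective line \<open>P(f\<^sub>i)\<close> with \<open>P(\<real> \<oplus> \<Lambda>\<^sup>2 f\<^sub>j)\<close>, in which \<open>\<tau>\<^sub>j\<close> is the point spanned by
  \<open>(1, \<tau>\<^sub>j)\<close>. The second condition identifies \<open>P(\<real> \<oplus> \<Lambda>\<^sup>2 f\<^sub>i)\<close> with \<open>P(f\<^sub>j)\<close>. The two together are a parallel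
  transport on the bundle with fibres \<open>P(f\<^sub>i) \<times> P(\<real> \<oplus> \<Lambda>\<^sup>2 f\<^sub>i)\<close>.

  This transport is flat on quadrilaterals: that is what closedness of \<open>\<eta>\<close> means, given that the four
  lines \<open>s\<^sub>i\<^sub>j\<close> of a quadrilateral are independent (\<open>flat_on_vectors\<close>, \<open>flat_on_potentials\<close>). As the domain is
  simply connected, a parallel section passes through every initial value
  (\<open>parallel_section_exists\<close>), and it is a Koenigs net as soon as its second component never
  meets the point at infinity \<open>0 \<oplus> \<Lambda>\<^sup>2 f\<^sub>i\<close> (\<open>koenigs_section_of_parallel\<close>). Two parallel sections that
  differ in both components at one vertex do so at every vertex. So in a one-parameter family of initial
  values with pairwise different components, each vertex rules out at most one value; the lattice is
  countable and the parameter is real, so two admissible values are left (\<open>koenigs_sections_exist\<close>).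
  The two nets \<open>(s, \<tau>)\<close> and \<open>(s', \<tau>')\<close> found in this way span \<open>f\<close>, and the nowhere vanishing values
  \<open>\<tau>' - \<tau>\<close> on the vertical edges complete them to a Koenigs--Moutard pair
  (\<open>koenigs_sections_moutard_pair\<close>).

  Conversely, the vertical values \<open>v\<^sub>i\<close> of the form of a Koenigs--Moutard pair lie in \<open>\<Lambda>\<^sup>2 f\<^sub>i\<close>, and closedness on
  vertical quadrilaterals reads \<open>\<eta>\<^sup>- = \<eta>\<^sup>+ + dv\<close>. In particular \<open>\<eta>\<^sup>+ \<and> s\<^sub>i\<^sub>j = \<eta>\<^sup>- \<and> s\<^sub>i\<^sub>j\<close>. This cannot vanish: as the
  four lines of the two nets over an edge are distinct, at most one of them is \<open>s\<^sub>i\<^sub>j\<close>, so one of the two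
  nets has both its lines different from \<open>s\<^sub>i\<^sub>j\<close> there, and then its two lines and \<open>s\<^sub>i\<^sub>j\<close> span
  \<open>f\<^sub>i + f\<^sub>j\<close> (\<open>moutard_pair_applicable\<close>).\<close>

section \<open>Nonvanishing wedge products\<close>

text \<open>The exterior algebra is given by generators and relations, so identities in it are easy while
  nonvanishing needs a linear functional that kills the ideal of relations. Such functionals come from
  functions on words that are multilinear and vanish on repeated neighbours.\<close>

definition alternating_on_words :: "('v::real_vector word \<Rightarrow> real) \<Rightarrow> bool" where
  "alternating_on_words D \<longleftrightarrow>
     (\<forall>a b u v. D (a + Word [u + v] + b) = D (a + Word [u] + b) + D (a + Word [v] + b)) \<and>
     (\<forall>a b c v. D (a + Word [c *\<^sub>R v] + b) = c * D (a + Word [v] + b)) \<and>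
     (\<forall>a b v. D (a + Word [v, v] + b) = 0)"

definition extend_linearly :: "('v word \<Rightarrow> real) \<Rightarrow> 'v free_alg \<Rightarrow> real" where
  "extend_linearly D p = (\<Sum>w\<in>Poly_Mapping.keys p. Poly_Mapping.lookup p w * D w)"

lemma extend_linearly_superset:
  assumes "finite A" "Poly_Mapping.keys p \<subseteq> A"
  shows "extend_linearly D p = (\<Sum>w\<in>A. Poly_Mapping.lookup p w * D w)"
  unfolding extend_linearly_def using assms
  by (intro sum.mono_neutral_left) (auto simp: in_keys_iff)

lemma extend_linearly_add: "extend_linearly D (p + q) = extend_linearly D p + extend_linearly D q"
proof -
  let ?A = "Poly_Mapping.keys p \<union> Poly_Mapping.keys q"
  have "Poly_Mapping.keys (p + q) \<subseteq> ?A" by (rule keys_add)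
  then show ?thesis
    by (subst (1 2 3) extend_linearly_superset[of ?A])
       (auto simp: lookup_add distrib_right sum.distrib)
qed

lemma extend_linearly_zero [simp]: "extend_linearly D 0 = 0"
  by (simp add: extend_linearly_def)

lemma extend_linearly_diff: "extend_linearly D (p - q) = extend_linearly D p - extend_linearly D q"
  using extend_linearly_add[of D "p - q" q] by simp

lemma extend_linearly_single [simp]: "extend_linearly D (Poly_Mapping.single w c) = c * D w"
  by (cases "c = 0") (simp_all add: extend_linearly_def)

lemma update_eq_add_single:
  assumes "a \<notin> Poly_Mapping.keys f"
  shows "Poly_Mapping.update a b f = f + Poly_Mapping.single a b"
  using assms by (intro poly_mapping_eqI)
    (auto simp: lookup_update lookup_add lookup_single not_in_keys_iff_lookup_eq_zero when_def)

lemma extend_linearly_single_mult: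
  "extend_linearly D (Poly_Mapping.single a c * x) = c * extend_linearly (\<lambda>w. D (a + w)) x"
proof (induction x rule: update_induct)
  case (update f w b)
  then show ?case
    by (simp add: update_eq_add_single distrib_left mult_single extend_linearly_add)
qed simp

lemma extend_linearly_mult_single:
  "extend_linearly D (x * Poly_Mapping.single a c) = c * extend_linearly (\<lambda>w. D (w + a)) x"
proof (induction x rule: update_induct)
  case (update f w b)
  then show ?case
    by (simp add: update_eq_add_single distrib_left distrib_right mult_single extend_linearly_add)
qed simp

lemma extend_linearly_mult_left_eq_0:
  assumes "\<And>a. extend_linearly (\<lambda>w. D (a + w)) x = 0"
  shows "extend_linearly D (p * x) = 0"
proof (induction p rule: update_induct)
  case (update f w b)
  then show ?case
    by (simp add: update_eq_add_single distrib_right extend_linearly_add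
        extend_linearly_single_mult assms)
qed simp

lemma extend_linearly_mult_right_eq_0:
  assumes "\<And>a. extend_linearly (\<lambda>w. D (w + a)) x = 0"
  shows "extend_linearly D (x * q) = 0"
proof (induction q rule: update_induct)
  case (update f w b)
  then show ?case
    by (simp add: update_eq_add_single distrib_left extend_linearly_add
        extend_linearly_mult_single assms)
qed simp

lemma alternating_shift:
  assumes "alternating_on_words D"
  shows "alternating_on_words (\<lambda>w. D (p + w))" "alternating_on_words (\<lambda>w. D (w + q))"
proof -
  have add: "D (a + Word [u + v] + b) = D (a + Word [u] + b) + D (a + Word [v] + b)"
    and scale: "D (a + Word [c *\<^sub>R v] + b) = c * D (a + Word [v] + b)"
    and square: "D (a + Word [v, v] + b) = 0" for a b c u v
    using assms unfolding alternating_on_words_def by blast+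
  show "alternating_on_words (\<lambda>w. D (p + w))"
    unfolding alternating_on_words_def
    using add[of "p + _"] scale[of "p + _"] square[of "p + _"] by (simp add: add.assoc)
  show "alternating_on_words (\<lambda>w. D (w + q))"
    unfolding alternating_on_words_def
    using add[of _ _ _ "_ + q"] scale[of _ _ _ "_ + q"] square[of _ _ "_ + q"]
    by (simp add: add.assoc)
qed

text \<open>The conditions on \<open>D\<close> are stable under prepending and appending words. This is why the
  induction must run for all \<open>D\<close> at once: multiplying an element of the ideal from both sides amounts to
  shifting \<open>D\<close>.\<close>

lemma alternating_vanishes_on_ideal:
  assumes "x \<in> ext_ideal" "alternating_on_words D"
  shows "extend_linearly D x = 0"
  using assms
proof (induction arbitrary: D rule: ext_ideal.induct)
  case (rel_add u v)
  then have "D (0 + Word [u + v] + 0) = D (0 + Word [u] + 0) + D (0 + Word [v] + 0)"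
    unfolding alternating_on_words_def by blast
  then show ?case by (simp add: extend_linearly_add extend_linearly_diff)
next
  case (rel_scale c v)
  then have "D (0 + Word [c *\<^sub>R v] + 0) = c * D (0 + Word [v] + 0)"
    unfolding alternating_on_words_def by blast
  then show ?case by (simp add: extend_linearly_diff mult_single)
next
  case (rel_square v)
  then have "D (0 + Word [v, v] + 0) = 0"
    unfolding alternating_on_words_def by blast
  then show ?case by (simp add: mult_single)
next
  case (mult x p q)
  have "extend_linearly D (p * (x * q)) = 0"
    by (intro extend_linearly_mult_left_eq_0 extend_linearly_mult_right_eq_0 mult.IH
        alternating_shift mult.prems)
  then show ?case by (simp add: mult.assoc)
qed (simp_all add: extend_linearly_add)

lemma wedge2_eq_0_iff: "ext_of u * ext_of v = 0 \<longleftrightarrow> gen u * gen v \<in> ext_ideal"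
  by (simp add: ext_of_def times_exterior.abs_eq zero_exterior_def exterior.abs_eq_iff)

lemma wedge3_eq_0_iff:
  "ext_of u * ext_of v * ext_of w = 0 \<longleftrightarrow> gen u * gen v * gen w \<in> ext_ideal"
  by (simp add: ext_of_def times_exterior.abs_eq zero_exterior_def exterior.abs_eq_iff)

text \<open>The functional is the determinant of a pair of dual coordinates on words of length two; for three
  vectors it is the three by three determinant on words of length three.\<close>

lemma wedge2_neq_0:
  assumes "u \<noteq> 0" "v \<notin> span {u}"
  shows "ext_of u * ext_of v \<noteq> 0"
proof -
  have "independent (insert v {u})"
    using assms by (intro independent_insertI independent_empty) auto
  then have ind: "independent {u, v}" by (simp add: insert_commute)
  have ne: "u \<noteq> v" using assms by (auto simp: span_base)
  obtain \<alpha> :: "'a \<Rightarrow> real" where \<alpha>: "linear \<alpha>" "\<alpha> u = 1" "\<alpha> v = 0"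
    using linear_independent_extend[OF ind, of "\<lambda>x. if x = u then 1 else 0"] ne by auto
  obtain \<beta> :: "'a \<Rightarrow> real" where \<beta>: "linear \<beta>" "\<beta> u = 0" "\<beta> v = 1"
    using linear_independent_extend[OF ind, of "\<lambda>x. if x = v then 1 else 0"] ne by auto
  define D where "D = (\<lambda>w. case w of Word [x, y] \<Rightarrow> \<alpha> x * \<beta> y - \<alpha> y * \<beta> x | _ \<Rightarrow> 0)"
  note lin = linear_add[OF \<alpha>(1)] linear_add[OF \<beta>(1)] linear_scale[OF \<alpha>(1)] linear_scale[OF \<beta>(1)]
  have "alternating_on_words D"
    unfolding alternating_on_words_def
  proof (intro conjI allI)
    fix a b :: "'a word" and x y :: 'a and c :: real
    obtain as bs where ab: "a = Word as" "b = Word bs" by (cases a; cases b)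
    have "as = [] \<or> (\<exists>p. as = [p]) \<or> (\<exists>p q. as = [p, q]) \<or> (\<exists>p q r as'. as = p # q # r # as')"
      by (metis list.exhaust)
    then show "D (a + Word [x + y] + b) = D (a + Word [x] + b) + D (a + Word [y] + b)"
      "D (a + Word [c *\<^sub>R x] + b) = c * D (a + Word [x] + b)"
      "D (a + Word [x, x] + b) = 0"
      by (elim disjE exE; simp add: D_def ab lin algebra_simps split: list.split)+
  qed
  then have "gen u * gen v \<notin> ext_ideal"
    using alternating_vanishes_on_ideal[of "gen u * gen v" D] \<alpha> \<beta> by (auto simp: D_def mult_single)
  then show ?thesis by (simp add: wedge2_eq_0_iff)
qed

lemma wedge3_neq_0:
  assumes "u \<noteq> 0" "v \<notin> span {u}" "w \<notin> span {u, v}"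
  shows "ext_of u * ext_of v * ext_of w \<noteq> 0"
proof -
  have "independent (insert w (insert v {u}))"
    using assms by (intro independent_insertI independent_empty) (auto simp: insert_commute)
  then have ind: "independent {u, v, w}" by (simp add: insert_commute)
  have ne: "u \<noteq> v" "u \<noteq> w" "v \<noteq> w" using assms by (auto simp: span_base)
  obtain \<alpha> :: "'a \<Rightarrow> real" where \<alpha>: "linear \<alpha>" "\<alpha> u = 1" "\<alpha> v = 0" "\<alpha> w = 0"
    using linear_independent_extend[OF ind, of "\<lambda>x. if x = u then 1 else 0"] ne by auto
  obtain \<beta> :: "'a \<Rightarrow> real" where \<beta>: "linear \<beta>" "\<beta> u = 0" "\<beta> v = 1" "\<beta> w = 0"
    using linear_independent_extend[OF ind, of "\<lambda>x. if x = v then 1 else 0"] ne by auto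
  obtain \<gamma> :: "'a \<Rightarrow> real" where \<gamma>: "linear \<gamma>" "\<gamma> u = 0" "\<gamma> v = 0" "\<gamma> w = 1"
    using linear_independent_extend[OF ind, of "\<lambda>x. if x = w then 1 else 0"] ne by auto
  define D where "D = (\<lambda>w. case w of Word [x, y, z] \<Rightarrow>
      \<alpha> x * (\<beta> y * \<gamma> z - \<beta> z * \<gamma> y) - \<alpha> y * (\<beta> x * \<gamma> z - \<beta> z * \<gamma> x)
      + \<alpha> z * (\<beta> x * \<gamma> y - \<beta> y * \<gamma> x) | _ \<Rightarrow> 0)"
  note lin = linear_add[OF \<alpha>(1)] linear_add[OF \<beta>(1)] linear_add[OF \<gamma>(1)]
    linear_scale[OF \<alpha>(1)] linear_scale[OF \<beta>(1)] linear_scale[OF \<gamma>(1)]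
  have "alternating_on_words D"
    unfolding alternating_on_words_def
  proof (intro conjI allI)
    fix a b :: "'a word" and x y :: 'a and c :: real
    obtain as bs where ab: "a = Word as" "b = Word bs" by (cases a; cases b)
    have "as = [] \<or> (\<exists>p. as = [p]) \<or> (\<exists>p q. as = [p, q]) \<or> (\<exists>p q r as'. as = p # q # r # as')"
      by (metis list.exhaust)
    then show "D (a + Word [x + y] + b) = D (a + Word [x] + b) + D (a + Word [y] + b)"
      "D (a + Word [c *\<^sub>R x] + b) = c * D (a + Word [x] + b)"
      "D (a + Word [x, x] + b) = 0"
      by (elim disjE exE; simp add: D_def ab lin algebra_simps split: list.split)+
  qed
  then have "gen u * gen v * gen w \<notin> ext_ideal"
    using alternating_vanishes_on_ideal[of "gen u * gen v * gen w" D] \<alpha> \<beta> \<gamma>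
    by (auto simp: D_def mult_single)
  then show ?thesis by (simp add: wedge3_eq_0_iff)
qed

section \<open>Calculus in the exterior algebra\<close>

lemmas ext_of_add = linear_add[OF linear_ext_of]
lemmas ext_of_scale = linear_scale[OF linear_ext_of]
lemmas ext_of_zero [simp] = linear_0[OF linear_ext_of]

lemma ext_of_anticommute: "ext_of u * ext_of v = - (ext_of v * ext_of u)"
proof -
  have "ext_of (u + v) * ext_of (u + v) = 0" by (rule ext_of_square)
  then have "ext_of u * ext_of v + ext_of v * ext_of u = 0"
    by (simp add: ext_of_add distrib_left distrib_right ext_of_square add.commute)
  then show ?thesis by (simp only: eq_neg_iff_add_eq_0)
qed

lemma ext_of_square_left: "ext_of u * (ext_of u * z) = 0"
  by (simp add: ext_of_square flip: mult.assoc)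

lemma ext_of_left_anticommute: "ext_of u * (ext_of v * z) = - (ext_of v * (ext_of u * z))"
proof -
  have "ext_of u * (ext_of v * z) = (- (ext_of v * ext_of u)) * z"
    by (subst ext_of_anticommute[symmetric]) (rule mult.assoc[symmetric])
  then show ?thesis by (simp only: mult.assoc mult_minus_left)
qed

text \<open>Together with instances of anticommutativity for chosen pairs of vectors, these rules bring
  products of linear combinations of fixed vectors into a normal form.\<close>

lemmas ext_simps = ext_of_add ext_of_scale ext_of_square ext_of_square_left distrib_left
  distrib_right left_diff_distrib right_diff_distrib mult.assoc scaleR_right_distrib
  scaleR_left_distrib scaleR_right_diff_distrib scaleR_left_diff_distrib

lemma wedge_span_singletons: "span {u} \<and>\<^sub>s span {v} = span {u * v}"
proof (rule antisym)
  have "a * b \<in> span {u * v}" if "a \<in> span {u}" "b \<in> span {v}" for a b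
    using that by (auto simp: span_singleton)
  then show "span {u} \<and>\<^sub>s span {v} \<subseteq> span {u * v}"
    unfolding wedge_def by (intro span_minimal) auto
  show "span {u * v} \<subseteq> span {u} \<and>\<^sub>s span {v}"
    unfolding wedge_def by (intro span_mono) (auto intro: span_base)
qed

lemma ext_sub_span: "ext_sub (span B) = span (ext_sub B)"
  using linear_span_image[OF linear_ext_of, of B] by simp

lemma wedge_lines: "ext_sub (span {x}) \<and>\<^sub>s ext_sub (span {y}) = span {ext_of x * ext_of y}"
  by (simp add: ext_sub_span wedge_span_singletons)

lemma wedge_singleton_line: "{\<xi>} \<and>\<^sub>s ext_sub (span {e}) = span {\<xi> * ext_of e}"
proof -
  have "{\<xi>} \<and>\<^sub>s ext_sub (span {e}) \<subseteq> span {\<xi>} \<and>\<^sub>s ext_sub (span {e})"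
    unfolding wedge_def by (intro span_mono) (auto intro: span_base)
  moreover have "span {\<xi> * ext_of e} \<subseteq> {\<xi>} \<and>\<^sub>s ext_sub (span {e})"
    unfolding wedge_def by (intro span_mono) (auto intro: span_base)
  ultimately show ?thesis by (simp add: ext_sub_span wedge_span_singletons)
qed

lemma subspace_Lambda2: "subspace (Lambda2 U)"
  by (simp add: Lambda2_def wedge_def)

lemma Lambda2_mono: "U \<subseteq> U' \<Longrightarrow> Lambda2 U \<subseteq> Lambda2 U'"
  unfolding Lambda2_def wedge_def by (intro span_mono) auto

lemma wedge_in_Lambda2: "x \<in> U \<Longrightarrow> y \<in> U \<Longrightarrow> ext_of x * ext_of y \<in> Lambda2 U"
  unfolding Lambda2_def wedge_def by (intro span_base) auto

lemma Lambda2_plane: "Lambda2 (span {a, b}) = span {ext_of a * ext_of b}"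
proof (rule antisym)
  have "ext_of x * ext_of y \<in> span {ext_of a * ext_of b}"
    if xy: "x \<in> span {a, b}" "y \<in> span {a, b}" for x y
  proof -
    obtain p q p' q' where "x = p *\<^sub>R a + q *\<^sub>R b" "y = p' *\<^sub>R a + q' *\<^sub>R b"
      using xy by (auto simp: span_breakdown_eq algebra_simps)
    then have "ext_of x * ext_of y = (p * q' - q * p') *\<^sub>R (ext_of a * ext_of b)"
      by (simp add: ext_simps ext_of_anticommute[of b a] mult.commute)
    then show ?thesis by (auto simp: span_singleton)
  qed
  then show "Lambda2 (span {a, b}) \<subseteq> span {ext_of a * ext_of b}"
    unfolding Lambda2_def wedge_def by (intro span_minimal) auto
  show "span {ext_of a * ext_of b} \<subseteq> Lambda2 (span {a, b})"
    by (intro span_minimal subspace_Lambda2) (auto intro: wedge_in_Lambda2 span_base)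
qed

lemma Lambda2_triple:
  assumes "\<xi> \<in> Lambda2 (span {a, b, c})"
  obtains p q r where "\<xi> = p *\<^sub>R (ext_of a * ext_of b) + q *\<^sub>R (ext_of a * ext_of c)
    + r *\<^sub>R (ext_of b * ext_of c)"
proof -
  let ?B = "{ext_of a * ext_of b, ext_of a * ext_of c, ext_of b * ext_of c}"
  have "ext_of x * ext_of y \<in> span ?B"
    if xy: "x \<in> span {a, b, c}" "y \<in> span {a, b, c}" for x y
  proof -
    obtain p q r where x: "x = p *\<^sub>R a + q *\<^sub>R b + r *\<^sub>R c"
      using xy(1) by (auto simp: span_breakdown_eq algebra_simps)
    obtain p' q' r' where y: "y = p' *\<^sub>R a + q' *\<^sub>R b + r' *\<^sub>R c"
      using xy(2) by (auto simp: span_breakdown_eq algebra_simps)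
    have "ext_of x * ext_of y = (p * q' - q * p') *\<^sub>R (ext_of a * ext_of b)
      + (p * r' - r * p') *\<^sub>R (ext_of a * ext_of c) + (q * r' - r * q') *\<^sub>R (ext_of b * ext_of c)"
      by (simp add: x y ext_simps ext_of_anticommute[of b a] ext_of_anticommute[of c a]
          ext_of_anticommute[of c b] mult.commute)
    then show ?thesis by (auto intro!: span_add span_scale intro: span_base)
  qed
  then have "Lambda2 (span {a, b, c}) \<subseteq> span ?B"
    unfolding Lambda2_def wedge_def by (intro span_minimal) auto
  then have "\<xi> \<in> span ?B" using assms by blast
  then show ?thesis using that by (auto simp: span_breakdown_eq algebra_simps)
qed

section \<open>Flat transport on simply connected domains\<close>

fun transport :: "('i \<Rightarrow> 'i \<Rightarrow> 'x \<Rightarrow> 'x) \<Rightarrow> 'i list \<Rightarrow> 'x \<Rightarrow> 'x" where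
  "transport g (i # j # p) x = transport g (j # p) (g j i x)"
| "transport g _ x = x"

lemma transport_append:
  "transport g (p @ i # q) x = transport g (i # q) (transport g (p @ [i]) x)"
proof (induction p arbitrary: x)
  case (Cons a p)
  then show ?case by (cases p) simp_all
qed simp

lemma edge_path_simps:
  "edge_path S [i] \<longleftrightarrow> i \<in> S"
  "edge_path S (i # j # p) \<longleftrightarrow> edge S i j \<and> edge_path S (j # p)"
  by (auto simp: edge_path_def edge_def)

lemma edge_path_append:
  "edge_path S (p @ i # q) \<longleftrightarrow> edge_path S (p @ [i]) \<and> edge_path S (i # q)"
proof (induction p)
  case Nil
  have "edge_path S (i # q) \<Longrightarrow> i \<in> S" by (simp add: edge_path_def)
  then show ?case by (auto simp: edge_path_simps)
next
  case (Cons a p)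
  then show ?case by (cases p) (auto simp: edge_path_simps)
qed

lemma edge_in: "edge S i j \<Longrightarrow> i \<in> S \<and> j \<in> S"
  by (auto simp: edge_def)

lemma edge_sym: "edge S i j \<Longrightarrow> edge S j i"
  by (auto simp: edge_def)

lemma quad_edges:
  assumes "quad S i j k l"
  shows "edge S i j" "edge S j k" "edge S k l" "edge S l i"
proof -
  obtain a b u v where S: "i \<in> S" "j \<in> S" "k \<in> S" "l \<in> S"
    and uv: "u \<in> {axis a 1, - axis a 1}" "v \<in> {axis b 1, - axis b 1}"
    and jkl: "j = i + u" "k = i + u + v" "l = i + v"
    using assms unfolding quad_def by auto
  have step: "edge S x y" if "x \<in> S" "y \<in> S" "y - x \<in> {axis c 1, - axis c 1}" for x y c
  proof -
    have "y = x + axis c 1 \<or> x = y + axis c 1"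
      using that(3) by (auto simp: algebra_simps)
    then show ?thesis using that(1,2) by (auto simp: edge_def)
  qed
  show "edge S i j" using step[of i j a] S uv jkl by simp
  show "edge S j k" using step[of j k b] S uv jkl by simp
  show "edge S k l" using edge_sym[OF step[of l k a]] S uv jkl by (simp add: algebra_simps)
  show "edge S l i" using edge_sym[OF step[of i l b]] S uv jkl by simp
qed

lemma quad_rotate: "quad S i j k l \<Longrightarrow> quad S j k l i"
proof -
  assume "quad S i j k l"
  then obtain a b u v where ab: "a \<noteq> b" and S: "i \<in> S" "j \<in> S" "k \<in> S" "l \<in> S"
    and uv: "u \<in> {axis a 1, - axis a 1}" "v \<in> {axis b 1, - axis b 1}"
    and jkl: "j = i + u" "k = i + u + v" "l = i + v"
    unfolding quad_def by auto
  then have "b \<noteq> a" "- u \<in> {axis a 1, - axis a 1}" "k = j + v" "l = j + v + - u" "i = j + - u"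
    by auto
  then show ?thesis using S uv(2) unfolding quad_def by blast
qed

lemma quad_reflect: "quad S i j k l \<Longrightarrow> quad S i l k j"
proof -
  assume "quad S i j k l"
  then obtain a b u v where "a \<noteq> b" and S: "i \<in> S" "j \<in> S" "k \<in> S" "l \<in> S"
    and uv: "u \<in> {axis a 1, - axis a 1}" "v \<in> {axis b 1, - axis b 1}"
    and jkl: "j = i + u" "k = i + u + v" "l = i + v"
    unfolding quad_def by auto
  then have "b \<noteq> a" "k = i + v + u" by (auto simp: algebra_simps)
  then show ?thesis using S uv jkl unfolding quad_def by blast
qed

text \<open>The fibres \<open>X i\<close> vary with the vertex, and nothing is known about \<open>g\<close> outside of them. Therefore
  invariance under the moves can only be shown for edge paths and for values in the initial fibre.\<close>

locale flat_transport =
  fixes S :: "(int^'n) set" and X :: "int^'n \<Rightarrow> 'x set" and g :: "int^'n \<Rightarrow> int^'n \<Rightarrow> 'x \<Rightarrow> 'x"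
  assumes maps: "edge S i j \<Longrightarrow> x \<in> X i \<Longrightarrow> g j i x \<in> X j"
    and inverse: "edge S i j \<Longrightarrow> x \<in> X i \<Longrightarrow> g i j (g j i x) = x"
    and flat: "quad S i j k l \<Longrightarrow> x \<in> X i \<Longrightarrow> g k j (g j i x) = g k l (g l i x)"
begin

lemma transport_maps: "edge_path S p \<Longrightarrow> x \<in> X (hd p) \<Longrightarrow> transport g p x \<in> X (last p)"
proof (induction p arbitrary: x rule: induct_list012)
  case (3 i j p)
  then show ?case using maps[of i j x] by (simp add: edge_path_simps)
qed (auto simp: edge_path_def)

text \<open>A spur is harmless because \<open>g i j\<close> inverts \<open>g j i\<close>, a flip because of flatness. The first three
  claims make the invariance usable along a chain of moves in either direction.\<close>

lemma path_move_invariant: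
  assumes "path_move S p q"
  shows "edge_path S p \<longleftrightarrow> edge_path S q" "hd q = hd p" "last q = last p"
    and "edge_path S p \<Longrightarrow> x \<in> X (hd p) \<Longrightarrow> transport g p x = transport g q x"
proof -
  have "(edge_path S p \<longleftrightarrow> edge_path S q) \<and> hd q = hd p \<and> last q = last p \<and>
    (edge_path S p \<longrightarrow> x \<in> X (hd p) \<longrightarrow> transport g p x = transport g q x)"
    using assms
  proof cases
    case (spur i j a b)
    have ends: "hd q = hd p" "last q = last p"
      unfolding spur by (cases a; simp) (cases b; simp)
    have path: "edge_path S p \<longleftrightarrow> edge_path S q"
      using spur(3) edge_sym[OF spur(3)] edge_in[OF spur(3)] unfolding spur
      by (simp add: edge_path_append[of S a i b] edge_path_append[of S a i "j # i # b"] edge_path_simps)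
    moreover have "transport g p x = transport g q x" if p: "edge_path S p" "x \<in> X (hd p)"
    proof -
      have "edge_path S (a @ [i])"
        using p(1) unfolding spur by (simp add: edge_path_append[of S a i b] edge_path_append[of S a i "j # i # b"])
      then have "transport g (a @ [i]) x \<in> X i"
        using transport_maps[of "a @ [i]" x] p(2) unfolding spur by (cases a) auto
      then show ?thesis
        unfolding spur by (simp add: transport_append[of g a i b] transport_append[of g a i "j # i # b"] inverse[OF spur(3)])
    qed
    ultimately show ?thesis using ends by blast
  next
    case (flip i j k l a b)
    note e = quad_edges[OF flip(3)]
    have ends: "hd q = hd p" "last q = last p"
      unfolding flip by (cases a; simp) (cases b; simp)
    have path: "edge_path S p \<longleftrightarrow> edge_path S q"
      using e[THEN edge_sym] e unfolding flip
      by (simp add: edge_path_append[of S a k "l # i # b"] edge_path_append[of S a k "j # i # b"] edge_path_simps)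
    moreover have "transport g p x = transport g q x" if p: "edge_path S p" "x \<in> X (hd p)"
    proof -
      have "edge_path S (a @ [k])"
        using p(1) unfolding flip by (simp add: edge_path_append[of S a k "l # i # b"] edge_path_append[of S a k "j # i # b"])
      then have "transport g (a @ [k]) x \<in> X k"
        using transport_maps[of "a @ [k]" x] p(2) unfolding flip by (cases a) auto
      then show ?thesis
        unfolding flip
        by (simp add: transport_append[of g a k "l # i # b"] transport_append[of g a k "j # i # b"] flat[OF quad_rotate[OF quad_rotate[OF flip(3)]]])
    qed
    ultimately show ?thesis using ends by blast
  qed
  then show "edge_path S p \<longleftrightarrow> edge_path S q" "hd q = hd p" "last q = last p"
    "edge_path S p \<Longrightarrow> x \<in> X (hd p) \<Longrightarrow> transport g p x = transport g q x" by blast+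
qed

lemma transport_homotopic:
  assumes "equivclp (path_move S) p q" "edge_path S p" "x \<in> X (hd p)"
  shows "transport g p x = transport g q x"
proof -
  have "edge_path S q \<and> hd q = hd p \<and> transport g p x = transport g q x"
    using assms(1)
  proof (induction rule: equivclp_induct)
    case base
    then show ?case using assms by simp
  next
    case (step q r)
    then show ?case
      using path_move_invariant(1-3)[of q r] path_move_invariant(1-3)[of r q]
        path_move_invariant(4)[of q r x] path_move_invariant(4)[of r q x] assms(3) by auto
  qed
  then show ?thesis by blast
qed

text \<open>The section transports \<open>x0\<close> along any path from \<open>i0\<close>. It is parallel along the edge from \<open>i\<close> to \<open>j\<close>
  since extending the chosen path to \<open>i\<close> by \<open>j\<close> gives a path homotopic to the chosen path to \<open>j\<close>.\<close>

lemma parallel_section_exists: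
  assumes S: "simply_connected_domain S" and i0: "i0 \<in> S" and x0: "x0 \<in> X i0"
  obtains \<sigma> where "\<sigma> i0 = x0" "\<And>i. i \<in> S \<Longrightarrow> \<sigma> i \<in> X i"
    "\<And>i j. edge S i j \<Longrightarrow> \<sigma> j = g j i (\<sigma> i)"
proof -
  have "\<forall>i\<in>S. \<exists>p. edge_path S p \<and> hd p = i0 \<and> last p = i"
    using S i0 unfolding simply_connected_domain_def by blast
  then obtain P where P: "\<And>i. i \<in> S \<Longrightarrow> edge_path S (P i) \<and> hd (P i) = i0 \<and> last (P i) = i"
    by metis
  have indep: "transport g p x0 = transport g q x0"
    if "edge_path S p" "edge_path S q" "hd p = i0" "hd q = i0" "last p = last q" for p q
    using that S x0 unfolding simply_connected_domain_def
    by (intro transport_homotopic) auto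
  define \<sigma> where "\<sigma> i = transport g (P i) x0" for i
  show ?thesis
  proof
    show "\<sigma> i0 = x0"
      using indep[of "P i0" "[i0]"] P[OF i0] i0 by (simp add: \<sigma>_def edge_path_simps)
    show "\<sigma> i \<in> X i" if "i \<in> S" for i
      using transport_maps[of "P i" x0] P[OF that] x0 by (simp add: \<sigma>_def)
    show "\<sigma> j = g j i (\<sigma> i)" if e: "edge S i j" for i j
    proof -
      have i: "i \<in> S" "j \<in> S" using edge_in[OF e] by auto
      obtain a where a: "P i = a @ [i]"
        using P[OF i(1)] by (metis append_butlast_last_id edge_path_def)
      have "edge_path S (a @ [i, j])" "hd (a @ [i, j]) = i0"
        using P[OF i(1)] e i by (simp_all add: a edge_path_append[of S a i "[j]"] edge_path_simps)
          (cases a; simp)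
      then have "transport g (P j) x0 = transport g (a @ [i, j]) x0"
        using P[OF i(2)] by (intro indep) auto
      then show ?thesis by (simp add: \<sigma>_def a transport_append[of g a i "[j]"])
    qed
  qed
qed

end

text \<open>Connectedness in the form used below: a property that passes along edges holds at every vertex
  once it holds at one.\<close>

lemma connected_induct:
  assumes S: "simply_connected_domain S" and i: "i \<in> S" "P i" and j: "j \<in> S"
    and step: "\<And>i j. edge S i j \<Longrightarrow> P i \<Longrightarrow> P j"
  shows "P j"
proof -
  have "edge_path S p \<Longrightarrow> P (hd p) \<Longrightarrow> P (last p)" for p
  proof (induction p rule: induct_list012)
    case (3 x y zs)
    then show ?case using step by (auto simp: edge_path_simps)
  qed (auto simp: edge_path_def)
  then show ?thesis using S i j unfolding simply_connected_domain_def by metis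
qed

section \<open>Lines, planes and frames of a regular line congruence\<close>

definition lines :: "'a::real_vector set \<Rightarrow> 'a set set" where
  "lines U = {span {x} | x. x \<in> U \<and> x \<noteq> 0}"

lemma span_singleton_eq: "x \<noteq> 0 \<Longrightarrow> x \<in> span {y} \<Longrightarrow> span {x} = span {y}"
proof -
  assume x: "x \<noteq> 0" "x \<in> span {y}"
  then obtain c where c: "x = c *\<^sub>R y" "c \<noteq> 0" by (auto simp: span_singleton)
  then have "y = inverse c *\<^sub>R x" by simp
  then have "y \<in> span {x}" by (metis span_base span_scale insertI1)
  then show "span {x} = span {y}" using x(2) by (intro antisym span_minimal) auto
qed

lemma lines_subset_eq: "L \<in> lines U \<Longrightarrow> L' \<in> lines U' \<Longrightarrow> L \<subseteq> L' \<Longrightarrow> L = L'"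
  by (auto simp: lines_def dest!: span_singleton_eq intro: span_base)

lemma line_subset: "L \<in> lines U \<Longrightarrow> subspace U \<Longrightarrow> L \<subseteq> U"
  unfolding lines_def using span_minimal[of _ U] by blast

lemma line_in_Grassmannian: "L \<in> lines U \<Longrightarrow> L \<in> Grassmannian 1"
  by (auto simp: lines_def Grassmannian_def dim_eq_card_independent)

lemma Grassmannian_1_E:
  assumes "L \<in> Grassmannian 1"
  obtains x where "x \<noteq> 0" "L = span {x}"
proof -
  have L: "subspace L" "dim L = 1" using assms by (auto simp: Grassmannian_def)
  obtain B where B: "B \<subseteq> L" "independent B" "L \<subseteq> span B" "card B = dim L"
    using basis_exists by blast
  then obtain x where x: "B = {x}" using L(2) card_1_singletonE by metis
  have "x \<noteq> 0" using B(2) x by auto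
  moreover have "L = span {x}" using B L(1) x by (simp add: antisym span_minimal)
  ultimately show ?thesis by (rule that)
qed

text \<open>Exchange against a basis of \<open>F\<close>: a third independent vector in \<open>F\<close> is impossible.\<close>

lemma plane_eq_span:
  assumes F: "F \<in> Grassmannian 2" and x: "x \<in> F" "x \<noteq> 0" and y: "y \<in> F" "y \<notin> span {x}"
  shows "F = span {x, y}"
proof (rule antisym)
  have sub: "subspace F" and "dim F = 2" using F by (auto simp: Grassmannian_def)
  then obtain B where B: "B \<subseteq> F" "independent B" "F \<subseteq> span B" "card B = 2"
    using basis_exists by metis
  then have finB: "finite B" using card.infinite by fastforce
  show "span {x, y} \<subseteq> F" using x y sub by (simp add: span_minimal)
  show "F \<subseteq> span {x, y}"
  proof
    fix z assume z: "z \<in> F"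
    show "z \<in> span {x, y}"
    proof (rule ccontr)
      assume nz: "z \<notin> span {x, y}"
      have ind: "independent (insert z (insert y {x}))"
        using x y nz by (intro independent_insertI independent_empty) (auto simp: insert_commute)
      have "card (insert z (insert y {x})) = 3"
        using nz y span_base[of z "{x, y}"] span_base[of y "{x}"] by (auto simp: card_insert_if)
      moreover have "card (insert z (insert y {x})) \<le> card B"
        using independent_span_bound[OF finB ind] B(3) x y z by auto
      ultimately show False using B(4) by simp
    qed
  qed
qed

lemma plane_not_in_line:
  assumes "F \<in> Grassmannian 2"
  obtains x where "x \<in> F" "x \<notin> span {e}"
proof -
  have "\<not> F \<subseteq> span {e}"
    using dim_le_card[of F "{e}"] assms by (auto simp: Grassmannian_def)
  then show ?thesis using that by blast
qed

lemma span_span_Un: "span (span A \<union> span B) = span (A \<union> B)"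
proof (rule antisym)
  show "span (span A \<union> span B) \<subseteq> span (A \<union> B)"
    by (intro span_minimal) (auto intro: span_mono[THEN subsetD])
  show "span (A \<union> B) \<subseteq> span (span A \<union> span B)"
    by (intro span_mono) (auto intro: span_base)
qed

locale regular_congruence =
  fixes S :: "(int^'n) set" and f :: "int^'n \<Rightarrow> 'v::real_vector set"
  assumes regular: "regular_line_congruence S f"
begin

lemma plane: "i \<in> S \<Longrightarrow> f i \<in> Grassmannian 2"
  using regular by (simp add: regular_line_congruence_def line_congruence_def)

lemma plane_subspace: "i \<in> S \<Longrightarrow> subspace (f i)"
  using plane by (simp add: Grassmannian_def)

text \<open>If the intersection contained two independent vectors, both planes would be equal, against the
  dimension of their sum.\<close>

lemma edge_meet:
  assumes e: "edge S i j"
  obtains e where "e \<noteq> 0" "f i \<inter> f j = span {e}"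
proof -
  note ij = edge_in[OF e]
  have dim3: "dim (span (f i \<union> f j)) = 3" and "f i \<inter> f j \<noteq> {0}"
    using regular e by (auto simp: regular_line_congruence_def line_congruence_def)
  moreover have sub: "subspace (f i \<inter> f j)"
    using ij plane_subspace by (simp add: subspace_inter)
  ultimately obtain e where e: "e \<in> f i" "e \<in> f j" "e \<noteq> 0"
    using subspace_0 by blast
  have "z \<in> span {e}" if z: "z \<in> f i" "z \<in> f j" for z
  proof (rule ccontr)
    assume "z \<notin> span {e}"
    then have "f i = span {e, z}" "f j = span {e, z}"
      using plane_eq_span[OF plane] ij e z by auto
    then have "dim (span (f i \<union> f j)) = dim (f i)" by simp
    then show False using dim3 plane[of i] ij by (simp add: Grassmannian_def)
  qed
  moreover have "span {e} \<subseteq> f i \<inter> f j" using sub e by (intro span_minimal) auto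
  ultimately have "f i \<inter> f j = span {e}" by blast
  then show ?thesis using that e by blast
qed

text \<open>Any two vectors of \<open>f i\<close> and \<open>f j\<close> off the common line complete it to a basis of \<open>f i + f j\<close>. In
  coordinates with respect to such a frame all questions about a single edge become explicit.\<close>

lemma edge_frame:
  assumes e: "edge S i j" and meet: "f i \<inter> f j = span {e}" "e \<noteq> 0"
    and x: "x \<in> f i" "x \<notin> span {e}" and y: "y \<in> f j" "y \<notin> span {e}"
  shows "f i = span {e, x}" "f j = span {e, y}" "span (f i \<union> f j) = span {e, x, y}"
    "ext_of e * ext_of x * ext_of y \<noteq> 0"
proof -
  note ij = edge_in[OF e]
  have "e \<in> f i" "e \<in> f j" using meet span_base[of e "{e}"] by auto
  then show fi: "f i = span {e, x}" and fj: "f j = span {e, y}"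
    using plane_eq_span[OF plane] ij meet x y by auto
  show "span (f i \<union> f j) = span {e, x, y}"
    unfolding fi fj span_span_Un by (rule arg_cong[of _ _ span]) auto
  have "y \<notin> span {e, x}" using fi meet y by blast
  then show "ext_of e * ext_of x * ext_of y \<noteq> 0" using meet x by (intro wedge3_neq_0)
qed

lemma edge_frame_exists:
  assumes "edge S i j"
  obtains e x y where "e \<noteq> 0" "f i \<inter> f j = span {e}" "x \<in> f i" "x \<notin> span {e}" "y \<in> f j"
    "y \<notin> span {e}"
  using edge_meet[OF assms] plane_not_in_line plane edge_in[OF assms] by metis

text \<open>Around a quadrilateral the four planes are spanned by cyclically consecutive vectors of four
  independent ones. The vector shared by \<open>f i\<close> and \<open>f j\<close> spans their intersection.\<close>

lemma quad_frame:
  assumes q: "quad S i j k l"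
  obtains e1 e2 e3 e4 where
    "f i \<inter> f j = span {e1}" "f j \<inter> f k = span {e2}" "f k \<inter> f l = span {e3}" "f l \<inter> f i = span {e4}"
    "f i = span {e4, e1}" "f j = span {e1, e2}" "f k = span {e2, e3}" "f l = span {e3, e4}"
    "ext_of e1 * (ext_of e2 * (ext_of e3 * ext_of e4)) \<noteq> 0"
proof -
  note edges = quad_edges[OF q]
  obtain e1 where e1: "f i \<inter> f j = span {e1}" using edge_meet[OF edges(1)] by metis
  obtain e2 where e2: "f j \<inter> f k = span {e2}" using edge_meet[OF edges(2)] by metis
  obtain e3 where e3: "f k \<inter> f l = span {e3}" using edge_meet[OF edges(3)] by metis
  obtain e4 where e4: "f l \<inter> f i = span {e4}" using edge_meet[OF edges(4)] by metis
  have "ext_sub (f i \<inter> f j) \<and>\<^sub>s ext_sub (f j \<inter> f k) \<and>\<^sub>s ext_sub (f k \<inter> f l) \<and>\<^sub>s ext_sub (f l \<inter> f i) \<noteq> {0}"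
    using regular q by (auto simp: regular_line_congruence_def)
  then have ne: "ext_of e1 * (ext_of e2 * (ext_of e3 * ext_of e4)) \<noteq> 0"
    by (auto simp: e1 e2 e3 e4 ext_sub_span wedge_span_singletons mult.assoc)
  have nz: "e1 \<noteq> 0" "e2 \<noteq> 0" "e3 \<noteq> 0" "e4 \<noteq> 0"
    using ne by auto
  have "e1 \<notin> span {e4}"
    using ne by (auto simp: span_singleton ext_simps ext_of_anticommute[of e3 e4]
        ext_of_left_anticommute[of e2 e4])
  moreover have "e2 \<notin> span {e1}" "e3 \<notin> span {e2}" "e4 \<notin> span {e3}"
    using ne by (auto simp: span_singleton ext_simps)
  ultimately have indep: "e1 \<notin> span {e4}" "e2 \<notin> span {e1}" "e3 \<notin> span {e2}" "e4 \<notin> span {e3}"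
    by blast+
  have mem: "e1 \<in> f i" "e1 \<in> f j" "e2 \<in> f j" "e2 \<in> f k" "e3 \<in> f k" "e3 \<in> f l" "e4 \<in> f l" "e4 \<in> f i"
    using e1 e2 e3 e4 span_base by blast+
  have "f i = span {e4, e1}" "f j = span {e1, e2}" "f k = span {e2, e3}" "f l = span {e3, e4}"
    using edges[THEN edge_in] by (rule_tac plane_eq_span[OF plane]; simp add: nz indep mem)+
  then show ?thesis using that e1 e2 e3 e4 ne by blast
qed

text \<open>Regularity of \<open>f\<close> forces regularity of sections that avoid the lines \<open>f i \<inter> f j\<close>. In the frame
  \<open>e1, e2, e3, e4\<close> only one monomial of \<open>x \<and> y \<and> z \<and> e2\<close> survives, and its coefficient is the product of
  the components of \<open>x, y, z\<close> that are nonzero by the hypotheses.\<close>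

lemma quad_section_independent:
  assumes q: "quad S i j k l"
    and x: "x \<in> f i" "x \<notin> f j" and y: "y \<in> f j" "y \<notin> f k" and z: "z \<in> f k" "z \<notin> f j"
  shows "ext_of x * ext_of y * ext_of z \<noteq> 0"
proof -
  obtain e1 e2 e3 e4 where frame: "f i = span {e4, e1}" "f j = span {e1, e2}" "f k = span {e2, e3}"
    and ne: "ext_of e1 * (ext_of e2 * (ext_of e3 * ext_of e4)) \<noteq> 0"
    using quad_frame[OF q] by metis
  obtain a b where x': "x = a *\<^sub>R e4 + b *\<^sub>R e1"
    using x(1) by (auto simp: frame span_breakdown_eq algebra_simps)
  obtain c d where y': "y = c *\<^sub>R e1 + d *\<^sub>R e2"
    using y(1) by (auto simp: frame span_breakdown_eq algebra_simps)
  obtain p r where z': "z = p *\<^sub>R e2 + r *\<^sub>R e3"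
    using z(1) by (auto simp: frame span_breakdown_eq algebra_simps)
  have "a \<noteq> 0" "c \<noteq> 0" "r \<noteq> 0"
    using x y z by (auto simp: frame x' y' z' span_base span_scale)
  moreover have "ext_of x * ext_of y * ext_of z * ext_of e2
      = (a * c * r) *\<^sub>R (ext_of e1 * (ext_of e2 * (ext_of e3 * ext_of e4)))"
    by (simp add: x' y' z' ext_simps ext_of_anticommute[of e4 e1] ext_of_anticommute[of e4 e2]
        ext_of_anticommute[of e4 e3] ext_of_anticommute[of e3 e1] ext_of_anticommute[of e3 e2]
        ext_of_anticommute[of e2 e1] ext_of_left_anticommute[of e4 e1] ext_of_left_anticommute[of e4 e2]
        ext_of_left_anticommute[of e4 e3] ext_of_left_anticommute[of e3 e1]
        ext_of_left_anticommute[of e3 e2] ext_of_left_anticommute[of e2 e1])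
  ultimately show ?thesis using ne by auto
qed

end

section \<open>The transport defined by an applicable line congruence\<close>

text \<open>The two halves of the transport are the annihilators with respect to the pairing
  \<open>(x, (t, \<omega>)) \<mapsto> x \<and> (t \<eta> + \<omega>)\<close>, where \<open>F\<close> is the plane of the target vertex. Defining them as
  annihilators of whole sets gives a Galois connection, so that they are inverse to each other as soon
  as both map lines to lines.\<close>

definition potentials_of ::
    "'v::real_vector set \<Rightarrow> 'v exterior \<Rightarrow> 'v set \<Rightarrow> (real \<times> 'v exterior) set" where
  "potentials_of F \<eta> L = {(t, \<omega>). \<omega> \<in> Lambda2 F \<and> (\<forall>x\<in>L. ext_of x * (t *\<^sub>R \<eta> + \<omega>) = 0)}"

definition vectors_of ::
    "'v::real_vector set \<Rightarrow> 'v exterior \<Rightarrow> (real \<times> 'v exterior) set \<Rightarrow> 'v set" where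
  "vectors_of F \<eta> T = {x \<in> F. \<forall>(t, \<omega>)\<in>T. ext_of x * (t *\<^sub>R \<eta> + \<omega>) = 0}"

abbreviation potentials :: "'v::real_vector set \<Rightarrow> (real \<times> 'v exterior) set" where
  "potentials F \<equiv> UNIV \<times> Lambda2 F"

lemma ball_line_iff:
  "(\<forall>x\<in>span {a}. ext_of x * \<xi> = 0) \<longleftrightarrow> ext_of a * \<xi> = 0"
proof
  show "ext_of a * \<xi> = 0" if "\<forall>x\<in>span {a}. ext_of x * \<xi> = 0"
    using that by (simp add: span_base)
qed (auto simp: span_singleton ext_of_scale)

lemma ball_potential_line_iff:
  fixes x :: "'v::real_vector exterior"
  shows "(\<forall>(t, \<omega>)\<in>span {(t0, \<omega>0)}. x * (t *\<^sub>R \<eta> + \<omega>) = 0) \<longleftrightarrow> x * (t0 *\<^sub>R \<eta> + \<omega>0) = 0"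
  (is "?all \<longleftrightarrow> ?gen")
proof
  show ?gen if ?all using that span_base[of "(t0, \<omega>0)" "{(t0, \<omega>0)}"] by blast
  have "x * ((k * t0) *\<^sub>R \<eta> + k *\<^sub>R \<omega>0) = k *\<^sub>R (x * (t0 *\<^sub>R \<eta> + \<omega>0))" for k
    by (simp add: distrib_left scaleR_right_distrib flip: scaleR_scaleR)
  then show ?all if ?gen using that by (auto simp: span_singleton)
qed

text \<open>In the frame \<open>e, a, b\<close>, where \<open>e\<close> spans the common line of the two planes, the pairing of
  \<open>\<alpha> e + \<beta> a\<close> with \<open>(t, c (e \<and> b))\<close> is the number \<open>\<alpha> t r - \<beta> (t q + c)\<close>. This bilinear form on two planes
  is nondegenerate because \<open>r \<noteq> 0\<close>, so annihilators of lines are lines.\<close>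

lemma
  assumes ne: "ext_of e * ext_of a * ext_of b \<noteq> 0" and r: "r \<noteq> 0"
    and \<eta>: "\<eta> = p *\<^sub>R (ext_of e * ext_of a) + q *\<^sub>R (ext_of e * ext_of b) + r *\<^sub>R (ext_of a * ext_of b)"
  shows potentials_of_line:
      "L \<in> lines (span {e, a}) \<Longrightarrow> potentials_of (span {e, b}) \<eta> L \<in> lines (potentials (span {e, b}))"
    and vectors_of_line:
      "T \<in> lines (potentials (span {e, b})) \<Longrightarrow> vectors_of (span {e, a}) \<eta> T \<in> lines (span {e, a})"
proof -
  let ?m = "ext_of e * (ext_of a * ext_of b)" and ?o = "ext_of e * ext_of b"
  have m: "?m \<noteq> 0" using ne by (simp add: mult.assoc)
  then have o: "?o \<noteq> 0" by (metis ext_of_left_anticommute mult_zero_right neg_0_equal_iff_equal)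
  have pairing: "ext_of (\<alpha> *\<^sub>R e + \<beta> *\<^sub>R a) * (t *\<^sub>R \<eta> + c *\<^sub>R ?o)
      = (\<alpha> * t * r - \<beta> * (t * q + c)) *\<^sub>R ?m" for \<alpha> \<beta> t c
    by (simp add: \<eta> ext_simps ext_of_left_anticommute[of a e] algebra_simps)
  have mem: "\<omega> \<in> Lambda2 (span {e, b}) \<longleftrightarrow> (\<exists>c. \<omega> = c *\<^sub>R ?o)" for \<omega>
    by (auto simp: Lambda2_plane span_singleton)
  \<comment> \<open>The vectors \<open>e\<close> and \<open>a\<close> are independent: wedging with \<open>a \<and> b\<close> and \<open>e \<and> b\<close> isolates the coefficients.\<close>
  have a: "\<beta> = 0 \<and> \<alpha> = 0" if "\<alpha> *\<^sub>R e + \<beta> *\<^sub>R a = 0" for \<alpha> \<beta>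
  proof -
    have "ext_of (\<alpha> *\<^sub>R e + \<beta> *\<^sub>R a) * (ext_of a * ext_of b) = \<alpha> *\<^sub>R ?m"
      "ext_of (\<alpha> *\<^sub>R e + \<beta> *\<^sub>R a) * (ext_of e * ext_of b) = - \<beta> *\<^sub>R ?m"
      by (simp_all add: ext_simps ext_of_left_anticommute[of a e])
    then have "\<alpha> *\<^sub>R ?m = 0" "- \<beta> *\<^sub>R ?m = 0" unfolding that by simp_all
    then show ?thesis using m by simp
  qed
  show "potentials_of (span {e, b}) \<eta> L \<in> lines (potentials (span {e, b}))"
    if "L \<in> lines (span {e, a})"
  proof -
    obtain x where x: "x \<in> span {e, a}" "x \<noteq> 0" "L = span {x}"
      using \<open>L \<in> lines (span {e, a})\<close> unfolding lines_def by blast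
    obtain \<alpha> \<beta> where x': "x = \<alpha> *\<^sub>R e + \<beta> *\<^sub>R a"
      using x(1) by (auto simp: span_breakdown_eq algebra_simps)
    define w where "w = (\<beta>, (\<alpha> * r - \<beta> * q) *\<^sub>R ?o)"
    have "potentials_of (span {e, b}) \<eta> L = {(t, c *\<^sub>R ?o) | t c. \<alpha> * t * r = \<beta> * (t * q + c)}"
      unfolding potentials_of_def x(3) x' ball_line_iff mem using m o by (auto simp: pairing)
    also have "\<dots> = span {w}"
    proof (intro antisym subsetI)
      fix z assume "z \<in> {(t, c *\<^sub>R ?o) | t c. \<alpha> * t * r = \<beta> * (t * q + c)}"
      then obtain t c where z: "z = (t, c *\<^sub>R ?o)" and tc: "\<alpha> * t * r = \<beta> * (t * q + c)" by blast
      show "z \<in> span {w}"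
      proof (cases "\<beta> = 0")
        case True
        then have "\<alpha> \<noteq> 0" "t = 0" using x(2) x' tc r by auto
        then have "z = (c / (\<alpha> * r)) *\<^sub>R w" using True r by (simp add: z w_def)
        then show ?thesis by (simp add: span_base span_scale)
      next
        case False
        then have "c = \<alpha> * t * r / \<beta> - t * q" using tc by (simp add: field_simps)
        then have "c = t / \<beta> * (\<alpha> * r - \<beta> * q)" using False by (simp add: field_simps)
        then have "z = (t / \<beta>) *\<^sub>R w" using False by (simp add: z w_def)
        then show ?thesis by (simp add: span_base span_scale)
      qed
    next
      fix z assume "z \<in> span {w}"
      then obtain k where "z = k *\<^sub>R w" by (auto simp: span_singleton)
      then have "z = (k * \<beta>, (k * (\<alpha> * r - \<beta> * q)) *\<^sub>R ?o)" by (simp add: w_def)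
      moreover have "\<alpha> * (k * \<beta>) * r = \<beta> * (k * \<beta> * q + k * (\<alpha> * r - \<beta> * q))"
        by (simp add: algebra_simps)
      ultimately show "z \<in> {(t, c *\<^sub>R ?o) | t c. \<alpha> * t * r = \<beta> * (t * q + c)}" by blast
    qed
    finally have "potentials_of (span {e, b}) \<eta> L = span {w}" .
    moreover have "w \<noteq> 0" using x(2) x' r o by (auto simp: w_def zero_prod_def)
    moreover have "w \<in> potentials (span {e, b})"
      by (simp add: w_def Lambda2_plane span_base span_scale)
    ultimately show ?thesis unfolding lines_def by blast
  qed
  show "vectors_of (span {e, a}) \<eta> T \<in> lines (span {e, a})"
    if "T \<in> lines (potentials (span {e, b}))"
  proof -
    obtain t c where w: "(t, c *\<^sub>R ?o) \<noteq> 0" "T = span {(t, c *\<^sub>R ?o)}"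
      using \<open>T \<in> lines _\<close> by (auto simp: lines_def Lambda2_plane span_singleton)
    have tc: "t \<noteq> 0 \<or> c \<noteq> 0" using w(1) by (auto simp: zero_prod_def)
    define x where "x = (t * q + c) *\<^sub>R e + (t * r) *\<^sub>R a"
    have span_ea: "z \<in> span {e, a} \<longleftrightarrow> (\<exists>\<alpha> \<beta>. z = \<alpha> *\<^sub>R e + \<beta> *\<^sub>R a)" for z
      by (auto simp: span_breakdown_eq algebra_simps)
    have "vectors_of (span {e, a}) \<eta> T = {\<alpha> *\<^sub>R e + \<beta> *\<^sub>R a | \<alpha> \<beta>. \<alpha> * t * r = \<beta> * (t * q + c)}"
      using m by (auto simp: vectors_of_def w(2) ball_potential_line_iff span_ea pairing) blast
    also have "\<dots> = span {x}"
    proof (intro antisym subsetI)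
      fix z assume "z \<in> {\<alpha> *\<^sub>R e + \<beta> *\<^sub>R a | \<alpha> \<beta>. \<alpha> * t * r = \<beta> * (t * q + c)}"
      then obtain \<alpha> \<beta> where z: "z = \<alpha> *\<^sub>R e + \<beta> *\<^sub>R a" and *: "\<alpha> * t * r = \<beta> * (t * q + c)"
        by blast
      show "z \<in> span {x}"
      proof (cases "t = 0")
        case True
        then have "z = (\<alpha> / c) *\<^sub>R x" using tc * by (simp add: z x_def)
        then show ?thesis by (simp add: span_base span_scale)
      next
        case False
        then have "\<alpha> = \<beta> / (t * r) * (t * q + c)" using * r by (simp add: field_simps)
        then have "z = (\<beta> / (t * r)) *\<^sub>R x" using False r by (simp add: z x_def scaleR_right_distrib)
        then show ?thesis by (simp add: span_base span_scale)
      qed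
    next
      fix z assume "z \<in> span {x}"
      then obtain k where "z = k *\<^sub>R x" by (auto simp: span_singleton)
      then have "z = (k * (t * q + c)) *\<^sub>R e + (k * (t * r)) *\<^sub>R a"
        by (simp add: x_def scaleR_right_distrib)
      moreover have "(k * (t * q + c)) * t * r = (k * (t * r)) * (t * q + c)" by simp
      ultimately show "z \<in> {\<alpha> *\<^sub>R e + \<beta> *\<^sub>R a | \<alpha> \<beta>. \<alpha> * t * r = \<beta> * (t * q + c)}" by blast
    qed
    finally have "vectors_of (span {e, a}) \<eta> T = span {x}" .
    moreover have "x \<noteq> 0" using a[of "t * q + c" "t * r"] tc r by (auto simp: x_def)
    moreover have "x \<in> span {e, a}" by (auto simp: x_def span_ea)
    ultimately show ?thesis unfolding lines_def by blast
  qed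
qed

locale applicable_congruence =
  fixes S :: "(int^'n) set" and f :: "int^'n \<Rightarrow> 'v::real_vector set"
    and \<eta> :: "int^'n \<Rightarrow> int^'n \<Rightarrow> 'v exterior"
  assumes applicable: "applicable_via S f \<eta>"

sublocale applicable_congruence \<subseteq> regular_congruence S f
  using applicable by unfold_locales (simp add: applicable_via_def)

context applicable_congruence
begin

lemma form_skew: "edge S i j \<Longrightarrow> \<eta> i j = - \<eta> j i"
  using applicable edge_sym[of S i j] unfolding applicable_via_def one_form_def by blast

lemma form_closed: "quad S i j k l \<Longrightarrow> \<eta> i l + \<eta> l k + \<eta> k j + \<eta> j i = 0"
  using applicable unfolding applicable_via_def closed_form_def by blast

lemma form_in_Lambda2: "edge S i j \<Longrightarrow> \<eta> j i \<in> Lambda2 (span (f i \<union> f j))"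
  using applicable edge_sym[of S i j] unfolding applicable_via_def by (metis Un_commute)

lemma form_wedge_meet:
  assumes "edge S i j" "f i \<inter> f j = span {e}"
  shows "\<eta> j i * ext_of e \<noteq> 0"
proof -
  have "{\<eta> j i} \<and>\<^sub>s ext_sub (f j \<inter> f i) \<noteq> {0}"
    using applicable edge_sym[OF assms(1)] unfolding applicable_via_def by blast
  then show ?thesis using assms(2) by (auto simp: Int_commute wedge_singleton_line)
qed

text \<open>The coefficient \<open>r\<close> is the value of \<open>\<eta> j i \<and> e\<close> relative to \<open>e \<and> x \<and> y\<close>; that it does not vanish
  is the transversality required of an applicable line congruence.\<close>

lemma form_coefficients:
  assumes edge: "edge S i j" and meet: "f i \<inter> f j = span {e}" "e \<noteq> 0"
    and x: "x \<in> f i" "x \<notin> span {e}" and y: "y \<in> f j" "y \<notin> span {e}"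
  obtains p q r where "r \<noteq> 0"
    "\<eta> j i = p *\<^sub>R (ext_of e * ext_of x) + q *\<^sub>R (ext_of e * ext_of y) + r *\<^sub>R (ext_of x * ext_of y)"
proof -
  note frame = edge_frame[OF assms]
  obtain p q r where *:
    "\<eta> j i = p *\<^sub>R (ext_of e * ext_of x) + q *\<^sub>R (ext_of e * ext_of y) + r *\<^sub>R (ext_of x * ext_of y)"
    using form_in_Lambda2[OF edge] unfolding frame(3) by (rule Lambda2_triple)
  have "r \<noteq> 0"
  proof
    assume "r = 0"
    then have "\<eta> j i * ext_of e = 0"
      by (simp add: * ext_simps ext_of_anticommute[of _ e])
    then show False using form_wedge_meet[OF edge meet(1)] by blast
  qed
  then show ?thesis using * by (rule that)
qed

lemma
  assumes edge: "edge S i j"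
  shows potentials_of_in_lines:
      "L \<in> lines (f i) \<Longrightarrow> potentials_of (f j) (\<eta> j i) L \<in> lines (potentials (f j))"
    and vectors_of_in_lines:
      "T \<in> lines (potentials (f j)) \<Longrightarrow> vectors_of (f i) (\<eta> j i) T \<in> lines (f i)"
proof -
  obtain e x y where frame: "f i \<inter> f j = span {e}" "e \<noteq> 0" "x \<in> f i" "x \<notin> span {e}" "y \<in> f j"
    "y \<notin> span {e}" using edge_frame_exists[OF edge] by metis
  note planes = edge_frame[OF edge frame]
  obtain p q r where r: "r \<noteq> 0" and form:
    "\<eta> j i = p *\<^sub>R (ext_of e * ext_of x) + q *\<^sub>R (ext_of e * ext_of y) + r *\<^sub>R (ext_of x * ext_of y)"
    using form_coefficients[OF edge frame] by metis
  show "L \<in> lines (f i) \<Longrightarrow> potentials_of (f j) (\<eta> j i) L \<in> lines (potentials (f j))"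
    using potentials_of_line[OF planes(4) r form] planes(1,2) by simp
  show "T \<in> lines (potentials (f j)) \<Longrightarrow> vectors_of (f i) (\<eta> j i) T \<in> lines (f i)"
    using vectors_of_line[OF planes(4) r form] planes(1,2) by simp
qed

lemma vectors_of_potentials_of:
  assumes edge: "edge S i j" and L: "L \<in> lines (f i)"
  shows "vectors_of (f i) (\<eta> j i) (potentials_of (f j) (\<eta> j i) L) = L"
proof -
  have "L \<subseteq> vectors_of (f i) (\<eta> j i) (potentials_of (f j) (\<eta> j i) L)"
    using line_subset[OF L plane_subspace] edge_in[OF edge]
    by (auto simp: vectors_of_def potentials_of_def)
  then show ?thesis
    using lines_subset_eq L vectors_of_in_lines[OF edge potentials_of_in_lines[OF edge L]] by metis
qed

lemma subspace_potentials: "subspace (potentials F)"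
  by (simp add: subspace_Times subspace_Lambda2)

lemma potentials_of_vectors_of:
  assumes edge: "edge S i j" and T: "T \<in> lines (potentials (f j))"
  shows "potentials_of (f j) (\<eta> j i) (vectors_of (f i) (\<eta> j i) T) = T"
proof -
  have "T \<subseteq> potentials_of (f j) (\<eta> j i) (vectors_of (f i) (\<eta> j i) T)"
    using line_subset[OF T subspace_potentials]
    by (auto simp: vectors_of_def potentials_of_def)
  then show ?thesis
    using lines_subset_eq T potentials_of_in_lines[OF edge vectors_of_in_lines[OF edge T]] by metis
qed

text \<open>Let \<open>x \<in> f i\<close> be paired to zero with \<open>(t, \<omega>)\<close> at \<open>j\<close> and with \<open>(s, \<zeta>)\<close> at \<open>l\<close>, and put
  \<open>A = t \<eta>\<^sub>j\<^sub>k + \<omega>\<close> and \<open>B = s \<eta>\<^sub>l\<^sub>k + \<zeta>\<close>. Closedness turns \<open>s\<close> times the first relation minus \<open>t\<close> times the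
  second into \<open>x \<and> (s A - t B) = 0\<close>. If \<open>y \<in> f k\<close> satisfies \<open>y \<and> A = 0\<close>, then wedging with \<open>y\<close> gives
  \<open>t (x \<and> y \<and> B) = 0\<close>. Now \<open>y \<and> B \<in> \<Lambda>\<^sup>3 (f k + f l)\<close> and \<open>x \<notin> f k + f l\<close>, because \<open>x \<notin> f l\<close>; hence \<open>y \<and> B = 0\<close>
  if \<open>t \<noteq> 0\<close>. The case \<open>t = 0\<close>, in which \<open>x\<close> spans \<open>f i \<inter> f j\<close> and \<open>y\<close> lies in \<open>f j \<inter> f k\<close>, is treated
  separately: there \<open>x \<and> y \<and> \<eta>\<close> vanishes on the two edges at \<open>j\<close>.\<close>

lemma flat_on_vectors_aux:
  assumes q: "quad S i j k l" and L: "L = span {x}" and x: "x \<in> f i" "x \<notin> f l"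
  shows "vectors_of (f k) (\<eta> j k) (potentials_of (f j) (\<eta> j i) L)
    \<subseteq> vectors_of (f k) (\<eta> l k) (potentials_of (f l) (\<eta> l i) L)"
proof
  fix y assume y: "y \<in> vectors_of (f k) (\<eta> j k) (potentials_of (f j) (\<eta> j i) L)"
  note edges = quad_edges[OF q]
  have "x \<noteq> 0" using x plane_subspace[of l] edge_in[OF edges(3)] subspace_0 by blast
  obtain e1 e2 e3 e4 where
    planes: "f i = span {e4, e1}" "f j = span {e1, e2}" "f k = span {e2, e3}" "f l = span {e3, e4}"
    and ne: "ext_of e1 * (ext_of e2 * (ext_of e3 * ext_of e4)) \<noteq> 0"
    using quad_frame[OF q] by metis
  let ?vol = "ext_of e1 * (ext_of e2 * (ext_of e3 * ext_of e4))"
  note sort = ext_of_anticommute[of e4 e1] ext_of_anticommute[of e4 e2]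
    ext_of_anticommute[of e4 e3] ext_of_anticommute[of e3 e1] ext_of_anticommute[of e3 e2]
    ext_of_anticommute[of e2 e1] ext_of_left_anticommute[of e4 e1] ext_of_left_anticommute[of e4 e2]
    ext_of_left_anticommute[of e4 e3] ext_of_left_anticommute[of e3 e1]
    ext_of_left_anticommute[of e3 e2] ext_of_left_anticommute[of e2 e1]
  obtain \<beta> \<alpha> where x': "x = \<beta> *\<^sub>R e4 + \<alpha> *\<^sub>R e1"
    using x(1) by (auto simp: planes span_breakdown_eq algebra_simps)
  have \<alpha>: "\<alpha> \<noteq> 0" using x(2) by (auto simp: planes x' span_base span_scale)
  have yk: "y \<in> f k" using y by (simp add: vectors_of_def)
  then obtain \<gamma> \<delta> where y': "y = \<gamma> *\<^sub>R e2 + \<delta> *\<^sub>R e3"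
    by (auto simp: planes span_breakdown_eq algebra_simps)
  have L_lines: "L \<in> lines (f i)" using L x(1) \<open>x \<noteq> 0\<close> by (auto simp: lines_def)
  have closed: "\<eta> j i - \<eta> l i = \<eta> j k - \<eta> l k"
  proof -
    have "(\<eta> j i - \<eta> l i) - (\<eta> j k - \<eta> l k) = \<eta> i l + \<eta> l k + \<eta> k j + \<eta> j i"
      by (simp add: form_skew[OF edge_sym[OF edges(2)]] form_skew[OF edge_sym[OF edges(4)]])
    then show ?thesis by (simp add: form_closed[OF q])
  qed
  obtain w where w: "potentials_of (f j) (\<eta> j i) L = span {w}" "w \<noteq> 0"
    using potentials_of_in_lines[OF edges(1) L_lines] unfolding lines_def by blast
  obtain t \<omega> where w': "w = (t, \<omega>)" by fastforce
  have "w \<in> potentials_of (f j) (\<eta> j i) L" unfolding w by (simp add: span_base)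
  then have \<omega>: "\<omega> \<in> Lambda2 (f j)" "ext_of x * (t *\<^sub>R \<eta> j i + \<omega>) = 0"
    "ext_of y * (t *\<^sub>R \<eta> j k + \<omega>) = 0"
    using y by (auto simp: potentials_of_def w' L ball_line_iff vectors_of_def)
  have "ext_of y * (s *\<^sub>R \<eta> l k + \<zeta>) = 0" if "(s, \<zeta>) \<in> potentials_of (f l) (\<eta> l i) L" for s \<zeta>
  proof -
    have \<zeta>: "\<zeta> \<in> Lambda2 (f l)" "ext_of x * (s *\<^sub>R \<eta> l i + \<zeta>) = 0"
      using that by (auto simp: potentials_of_def L ball_line_iff)
    let ?B = "s *\<^sub>R \<eta> l k + \<zeta>"
    have zero: "ext_of x * (ext_of y * ?B) = 0"
    proof (cases "t = 0")
      case False
      have "ext_of x * (s *\<^sub>R (t *\<^sub>R \<eta> j k + \<omega>) - t *\<^sub>R ?B)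
        = ext_of x * ((s * t) *\<^sub>R (\<eta> j k - \<eta> l k) + s *\<^sub>R \<omega> - t *\<^sub>R \<zeta>)"
        by (simp add: algebra_simps)
      also have "\<dots> = s *\<^sub>R (ext_of x * (t *\<^sub>R \<eta> j i + \<omega>)) - t *\<^sub>R (ext_of x * (s *\<^sub>R \<eta> l i + \<zeta>))"
        unfolding closed[symmetric] by (simp add: algebra_simps)
      also have "\<dots> = 0" by (simp add: \<omega> \<zeta>)
      finally have "ext_of y * (ext_of x * (s *\<^sub>R (t *\<^sub>R \<eta> j k + \<omega>) - t *\<^sub>R ?B)) = 0" by simp
      then have "ext_of x * (ext_of y * (s *\<^sub>R (t *\<^sub>R \<eta> j k + \<omega>) - t *\<^sub>R ?B)) = 0"
        by (simp add: ext_of_left_anticommute[of x])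
      then have "ext_of x * (s *\<^sub>R (ext_of y * (t *\<^sub>R \<eta> j k + \<omega>)) - t *\<^sub>R (ext_of y * ?B)) = 0"
        by (simp add: right_diff_distrib)
      then show ?thesis using False by (simp add: \<omega> right_diff_distrib)
    next
      case True
      obtain c where c: "\<omega> = c *\<^sub>R (ext_of e1 * ext_of e2)"
        using \<omega>(1) by (auto simp: planes Lambda2_plane span_singleton)
      have "c \<noteq> 0" using w(2) True by (auto simp: w' c zero_prod_def)
      have "ext_of x * \<omega> * ext_of e3 = 0" using \<omega>(2) True by simp
      then have "(c * \<beta>) *\<^sub>R ?vol = 0"
        by (simp add: x' c ext_simps sort mult.commute)
      then have x1: "x = \<alpha> *\<^sub>R e1" using \<open>c \<noteq> 0\<close> ne by (simp add: x')
      have "ext_of y * \<omega> * ext_of e4 = 0" using \<omega>(3) True by simp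
      then have "(c * \<delta>) *\<^sub>R ?vol = 0"
        by (simp add: y' c ext_simps sort mult.commute)
      then have y2: "y = \<gamma> *\<^sub>R e2" using \<open>c \<noteq> 0\<close> ne by (simp add: y')
      have "span (f j \<union> f k) = span {e1, e2, e3}" "span (f i \<union> f j) = span {e1, e2, e4}"
        unfolding planes span_span_Un by (simp_all add: insert_commute)
      then have "\<eta> j k \<in> Lambda2 (span {e1, e2, e3})" "\<eta> j i \<in> Lambda2 (span {e1, e2, e4})"
        using form_in_Lambda2[OF edge_sym[OF edges(2)]] form_in_Lambda2[OF edges(1)]
        by (simp_all add: Un_commute)
      then have "ext_of e1 * (ext_of e2 * \<eta> j k) = 0" "ext_of e1 * (ext_of e2 * \<eta> j i) = 0"
        by (auto elim!: Lambda2_triple simp: ext_simps sort)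
      then have "ext_of x * (ext_of y * (\<eta> j i - \<eta> j k)) = 0"
        by (simp add: x1 y2 ext_simps)
      moreover have "\<eta> l k = \<eta> l i - (\<eta> j i - \<eta> j k)" using closed by (simp add: algebra_simps)
      ultimately have "ext_of x * (ext_of y * ?B) = ext_of x * (ext_of y * (s *\<^sub>R \<eta> l i + \<zeta>))"
        by (simp add: distrib_left right_diff_distrib scaleR_right_diff_distrib)
      also have "\<dots> = - (ext_of y * (ext_of x * (s *\<^sub>R \<eta> l i + \<zeta>)))"
        by (rule ext_of_left_anticommute)
      finally show ?thesis by (simp add: \<zeta>)
    qed
    have "span (f k \<union> f l) = span {e2, e3, e4}"
      unfolding planes span_span_Un by (simp_all add: insert_commute)
    then have "\<eta> l k \<in> Lambda2 (span {e2, e3, e4})"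
      using form_in_Lambda2[OF edges(3)] by simp
    then obtain p q r where form: "\<eta> l k = p *\<^sub>R (ext_of e2 * ext_of e3)
        + q *\<^sub>R (ext_of e2 * ext_of e4) + r *\<^sub>R (ext_of e3 * ext_of e4)"
      by (rule Lambda2_triple)
    obtain d where d: "\<zeta> = d *\<^sub>R (ext_of e3 * ext_of e4)"
      using \<zeta>(1) by (auto simp: planes Lambda2_plane span_singleton)
    define m where "m = \<gamma> * (s * r + d) - \<delta> * s * q"
    have yB: "ext_of y * ?B = m *\<^sub>R (ext_of e2 * (ext_of e3 * ext_of e4))"
      by (simp add: y' form d m_def ext_simps sort algebra_simps)
    have "ext_of x * (ext_of y * ?B) = (\<alpha> * m) *\<^sub>R ?vol"
      unfolding yB by (simp add: x' ext_simps sort mult.commute)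
    then have "m = 0" using zero \<alpha> ne by simp
    then show ?thesis by (simp add: yB)
  qed
  then show "y \<in> vectors_of (f k) (\<eta> l k) (potentials_of (f l) (\<eta> l i) L)"
    using yk by (auto simp: vectors_of_def)
qed

text \<open>A nonzero \<open>x \<in> f i\<close> cannot lie in both \<open>f j\<close> and \<open>f l\<close>. So one of the two inclusions between the
  transported lines holds, and an inclusion of lines is an equality.\<close>

lemma flat_on_vectors:
  assumes q: "quad S i j k l" and L: "L \<in> lines (f i)"
  shows "vectors_of (f k) (\<eta> j k) (potentials_of (f j) (\<eta> j i) L)
    = vectors_of (f k) (\<eta> l k) (potentials_of (f l) (\<eta> l i) L)" (is "?A = ?B")
proof -
  note edges = quad_edges[OF q]
  obtain x where x: "L = span {x}" "x \<in> f i" "x \<noteq> 0" using L unfolding lines_def by blast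
  have lines: "?A \<in> lines (f k)" "?B \<in> lines (f k)"
    using L edges edge_sym by (auto intro!: vectors_of_in_lines potentials_of_in_lines)
  obtain e1 e4 where meet: "f i \<inter> f j = span {e1}" "f l \<inter> f i = span {e4}"
    and ne: "ext_of e4 * ext_of e1 \<noteq> 0"
  proof -
    obtain e1 e2 e3 e4 where "f i \<inter> f j = span {e1}" "f l \<inter> f i = span {e4}"
      "ext_of e1 * (ext_of e2 * (ext_of e3 * ext_of e4)) \<noteq> 0" using quad_frame[OF q] by metis
    moreover from this have "ext_of e4 * ext_of e1 \<noteq> 0"
      by (metis ext_of_anticommute ext_of_left_anticommute mult_zero_right neg_0_equal_iff_equal)
    ultimately show ?thesis using that by blast
  qed
  \<comment> \<open>The lines of \<open>f i\<close> shared with its two neighbours are different.\<close>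
  have "\<not> (x \<in> f j \<and> x \<in> f l)"
  proof
    assume "x \<in> f j \<and> x \<in> f l"
    then have "x \<in> span {e1}" "x \<in> span {e4}" using x(2) meet by blast+
    then have "span {e1} = span {e4}" using span_singleton_eq[OF x(3)] by metis
    then have "e1 \<in> span {e4}" by (metis span_base singletonI)
    then show False using ne by (auto simp: span_singleton ext_simps)
  qed
  then consider "x \<notin> f l" | "x \<notin> f j" by blast
  then show ?thesis
  proof cases
    case 1
    then show ?thesis using flat_on_vectors_aux[OF q x(1,2)] lines lines_subset_eq by metis
  next
    case 2
    then show ?thesis
      using flat_on_vectors_aux[OF quad_reflect[OF q] x(1,2)] lines lines_subset_eq by metis
  qed
qed

text \<open>Flatness of the other half follows by inverting flatness on vectors for the quadrilateral read
  from \<open>j\<close>.\<close>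

lemma flat_on_potentials:
  assumes q: "quad S i j k l" and T: "T \<in> lines (potentials (f i))"
  shows "potentials_of (f k) (\<eta> k j) (vectors_of (f j) (\<eta> i j) T)
    = potentials_of (f k) (\<eta> k l) (vectors_of (f l) (\<eta> i l) T)"
proof -
  note edges = quad_edges[OF q]
  let ?M = "vectors_of (f j) (\<eta> i j) T"
  have M: "?M \<in> lines (f j)" using T edges edge_sym by (intro vectors_of_in_lines)
  have "vectors_of (f l) (\<eta> k l) (potentials_of (f k) (\<eta> k j) ?M)
    = vectors_of (f l) (\<eta> i l) (potentials_of (f i) (\<eta> i j) ?M)"
    by (rule flat_on_vectors[OF quad_rotate[OF q] M])
  also have "\<dots> = vectors_of (f l) (\<eta> i l) T"
    by (simp add: potentials_of_vectors_of[OF edge_sym[OF edges(1)] T])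
  finally show ?thesis
    using potentials_of_vectors_of[OF edge_sym[OF edges(3)] potentials_of_in_lines[OF edges(2) M]]
    by simp
qed

definition step where
  "step j i = (\<lambda>(L, T). (vectors_of (f j) (\<eta> i j) T, potentials_of (f j) (\<eta> j i) L))"

sublocale flat_transport S "\<lambda>i. lines (f i) \<times> lines (potentials (f i))" step
proof
  fix i j k l x
  assume x: "x \<in> lines (f i) \<times> lines (potentials (f i))"
  show "step j i x \<in> lines (f j) \<times> lines (potentials (f j))" if "edge S i j"
    using x vectors_of_in_lines[OF edge_sym[OF that]] potentials_of_in_lines[OF that]
    by (auto simp: step_def)
  show "step i j (step j i x) = x" if "edge S i j"
    using x vectors_of_potentials_of[OF that] potentials_of_vectors_of[OF edge_sym[OF that]]
    by (auto simp: step_def)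
  show "step k j (step j i x) = step k l (step l i x)" if "quad S i j k l"
    using x flat_on_vectors[OF that] flat_on_potentials[OF that] by (auto simp: step_def)
qed

end

section \<open>Koenigs nets inside an applicable line congruence\<close>

lemma Grassmannian_2_E:
  assumes F: "F \<in> Grassmannian 2"
  obtains a b where "F = span {a, b}" "ext_of a * ext_of b \<noteq> 0"
proof -
  obtain a where a: "a \<in> F" "a \<notin> span {0}" using plane_not_in_line[OF F] by metis
  obtain b where b: "b \<in> F" "b \<notin> span {a}" using plane_not_in_line[OF F] by metis
  have "a \<noteq> 0" using a(2) span_zero by blast
  then show ?thesis using that plane_eq_span[OF F a(1) _ b] wedge2_neq_0[OF _ b(2)] by blast
qed

lemma Lambda2_plane_annihilated:
  assumes "F \<in> Grassmannian 2" "x \<in> F" "\<omega> \<in> Lambda2 F"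
  shows "ext_of x * \<omega> = 0" "\<omega> * ext_of x = 0"
proof -
  obtain a b where F: "F = span {a, b}" using Grassmannian_2_E[OF assms(1)] by metis
  obtain c where "\<omega> = c *\<^sub>R (ext_of a * ext_of b)"
    using assms(3) by (auto simp: F Lambda2_plane span_singleton)
  moreover obtain p q where "x = p *\<^sub>R a + q *\<^sub>R b"
    using assms(2) by (auto simp: F span_breakdown_eq algebra_simps)
  ultimately show "ext_of x * \<omega> = 0" "\<omega> * ext_of x = 0"
    by (simp_all add: ext_simps ext_of_anticommute[of b a] ext_of_left_anticommute[of b a])
qed

text \<open>The points of the projective line of \<open>\<real> \<oplus> \<Lambda>\<^sup>2 F\<close> that do not come from a potential \<open>\<tau>\<close>; by the
  next lemma there is only one.\<close>

definition at_infinity :: "(real \<times> 'w) set \<Rightarrow> bool" where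
  "at_infinity T \<longleftrightarrow> (\<forall>\<tau>. (1, \<tau>) \<notin> T)"

lemma at_infinity_unique:
  assumes F: "F \<in> Grassmannian 2" and T: "T \<in> lines (potentials F)" "at_infinity T"
    and T': "T' \<in> lines (potentials F)" "at_infinity T'"
  shows "T = T'"
proof -
  obtain a b where ab: "F = span {a, b}" using Grassmannian_2_E[OF F] by metis
  have "T = span {(0, ext_of a * ext_of b)}"
    if T: "T \<in> lines (potentials F)" "at_infinity T" for T
  proof -
    obtain t \<omega> where w: "(t, \<omega>) \<noteq> 0" "T = span {(t, \<omega>)}" "\<omega> \<in> Lambda2 F"
      using T(1) by (auto simp: lines_def)
    have "t = 0"
    proof (rule ccontr)
      assume "t \<noteq> 0"
      then have "(1, (1 / t) *\<^sub>R \<omega>) = (1 / t) *\<^sub>R (t, \<omega>)" by simp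
      then have "(1, (1 / t) *\<^sub>R \<omega>) \<in> T" by (simp only: w span_base span_scale insertI1)
      then show False using T(2) by (auto simp: at_infinity_def)
    qed
    moreover obtain c where "\<omega> = c *\<^sub>R (ext_of a * ext_of b)"
      using w(3) by (auto simp: ab Lambda2_plane span_singleton)
    ultimately have "(t, \<omega>) = c *\<^sub>R (0, ext_of a * ext_of b)" by simp
    then have "(t, \<omega>) \<in> span {(0, ext_of a * ext_of b)}" by (metis span_base span_scale insertI1)
    then show ?thesis using span_singleton_eq[OF w(1)] w(2) by simp
  qed
  then show ?thesis using assms by metis
qed

lemma wedge3_neq_0_D:
  assumes "ext_of x * ext_of y * ext_of z \<noteq> 0"
  shows "x \<noteq> 0" "y \<notin> span {x}" "z \<notin> span {x, y}"
proof -
  show "x \<noteq> 0" "y \<notin> span {x}" using assms by (auto simp: span_singleton ext_simps)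
  show "z \<notin> span {x, y}"
  proof
    assume "z \<in> span {x, y}"
    then obtain a b where "z = a *\<^sub>R x + b *\<^sub>R y" by (auto simp: span_breakdown_eq algebra_simps)
    then show False using assms by (simp add: ext_simps ext_of_anticommute[of y x])
  qed
qed

lemma dim_ge_3:
  assumes ne: "ext_of x * ext_of y * ext_of z \<noteq> 0" and U: "{x, y, z} \<subseteq> U"
    and W: "finite W" "U \<subseteq> span W"
  shows "3 \<le> dim (span U)"
proof -
  note indep = wedge3_neq_0_D[OF ne]
  have ind: "independent (insert z (insert y {x}))"
    using indep by (intro independent_insertI independent_empty) (auto simp: insert_commute)
  have card: "card (insert z (insert y {x})) = 3"
    using indep span_base[of z "{x, y}"] span_base[of y "{x}"] by (auto simp: card_insert_if)
  obtain B where B: "B \<subseteq> U" "independent B" "U \<subseteq> span B" "card B = dim U"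
    using basis_exists by metis
  have "finite B" using independent_span_bound[OF W(1) B(2)] B(1) W(2) by auto
  then have "card (insert z (insert y {x})) \<le> card B"
    using independent_span_bound[OF _ ind] B(3) U by auto
  then show ?thesis using card B(4) by simp
qed

lemma dim_lines_ge_3:
  assumes "A \<in> Grassmannian 1" "B \<in> Grassmannian 1" "C \<in> Grassmannian 1" "D \<in> Grassmannian 1"
    and "ext_of x * ext_of y * ext_of z \<noteq> 0" "{x, y, z} \<subseteq> A \<union> B \<union> C \<union> D"
  shows "3 \<le> dim (span (A \<union> B \<union> C \<union> D))"
proof -
  obtain a b c d where "A = span {a}" "B = span {b}" "C = span {c}" "D = span {d}"
    using assms(1-4) Grassmannian_1_E by metis
  then have "A \<union> B \<union> C \<union> D \<subseteq> span {a, b, c, d}"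
    using span_mono[of _ "{a, b, c, d}"] by auto
  then show ?thesis by (intro dim_ge_3[OF assms(5,6), of "{a, b, c, d}"]) simp_all
qed

context applicable_congruence
begin

text \<open>The data of a Koenigs net inside \<open>f\<close> whose form lies in the class of \<open>\<eta>\<close>. The condition
  \<open>\<not> s i \<subseteq> f j\<close> says that \<open>s i\<close> is not the intersection line of the edge; it gives the regularity of the
  net.\<close>

definition koenigs_section ::
    "(int^'n \<Rightarrow> 'v set) \<Rightarrow> (int^'n \<Rightarrow> 'v exterior) \<Rightarrow> bool" where
  "koenigs_section s \<tau> \<longleftrightarrow> (\<forall>i\<in>S. s i \<in> lines (f i) \<and> \<tau> i \<in> Lambda2 (f i)) \<and>
     (\<forall>i j. edge S i j \<longrightarrow> \<not> s i \<subseteq> f j \<and> \<eta> j i + diff_form \<tau> j i \<noteq> 0 \<and>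
        \<eta> j i + diff_form \<tau> j i \<in> ext_sub (s j) \<and>\<^sub>s ext_sub (s i))"

definition parallel :: "(int^'n \<Rightarrow> 'v set \<times> (real \<times> 'v exterior) set) \<Rightarrow> bool" where
  "parallel \<sigma> \<longleftrightarrow> (\<forall>i\<in>S. \<sigma> i \<in> lines (f i) \<times> lines (potentials (f i))) \<and>
     (\<forall>i j. edge S i j \<longrightarrow> \<sigma> j = step j i (\<sigma> i))"

text \<open>The line \<open>f i \<inter> f j\<close> corresponds to the point at infinity at \<open>j\<close>: for \<open>x\<close> in it, \<open>x \<and> \<tau> = 0\<close> for
  every \<open>\<tau> \<in> \<Lambda>\<^sup>2 (f j)\<close>, while \<open>x \<and> \<eta> j i \<noteq> 0\<close>.\<close>

lemma parallel_line_not_in_neighbour: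
  assumes "parallel \<sigma>" and fin: "\<And>i. i \<in> S \<Longrightarrow> \<not> at_infinity (snd (\<sigma> i))" and e: "edge S i j"
  shows "\<not> fst (\<sigma> i) \<subseteq> f j"
proof
  assume sub: "fst (\<sigma> i) \<subseteq> f j"
  note ij = edge_in[OF e]
  have "fst (\<sigma> i) \<in> lines (f i)" using assms(1) ij by (auto simp: parallel_def mem_Times_iff)
  then obtain x where x: "fst (\<sigma> i) = span {x}" "x \<in> f i" "x \<noteq> 0" by (auto simp: lines_def)
  have xj: "x \<in> f j" using sub x(1) span_base by blast
  obtain \<tau> where "(1, \<tau>) \<in> snd (\<sigma> j)" using fin ij by (auto simp: at_infinity_def)
  moreover have "snd (\<sigma> j) = potentials_of (f j) (\<eta> j i) (fst (\<sigma> i))"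
    using assms(1) e by (auto simp: parallel_def step_def split_beta)
  ultimately have \<tau>: "\<tau> \<in> Lambda2 (f j)" "ext_of x * (\<eta> j i + \<tau>) = 0"
    by (auto simp: potentials_of_def x(1) ball_line_iff)
  have zero: "ext_of x * \<eta> j i = 0"
    using \<tau> Lambda2_plane_annihilated(1)[OF plane xj \<tau>(1)] ij by (simp add: distrib_left)
  obtain e' a b where frame: "f i \<inter> f j = span {e'}" "e' \<noteq> 0" "a \<in> f i" "a \<notin> span {e'}" "b \<in> f j"
    "b \<notin> span {e'}" using edge_frame_exists[OF e] by metis
  have "x \<in> span {e'}" using x(2) xj frame(1) by blast
  then obtain k where k: "x = k *\<^sub>R e'" "k \<noteq> 0" using x(3) by (auto simp: span_singleton)
  obtain p q r where "r \<noteq> 0" "\<eta> j i = p *\<^sub>R (ext_of e' * ext_of a) + q *\<^sub>R (ext_of e' * ext_of b)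
    + r *\<^sub>R (ext_of a * ext_of b)"
    using form_coefficients[OF e frame] by metis
  then show False using zero k edge_frame(4)[OF e frame] by (simp add: ext_simps)
qed

text \<open>In a frame \<open>e', x, y\<close> adapted to the edge, the two parallelism conditions say that the potentials
  cancel the components of \<open>\<eta> j i\<close> along \<open>e' \<and> x\<close> and \<open>e' \<and> y\<close>, which leaves a nonzero multiple of
  \<open>x \<and> y\<close>.\<close>

lemma koenigs_section_of_parallel:
  assumes par: "parallel \<sigma>" and fin: "\<And>i. i \<in> S \<Longrightarrow> (1, \<tau> i) \<in> snd (\<sigma> i)"
  shows "koenigs_section (\<lambda>i. fst (\<sigma> i)) \<tau>"
  unfolding koenigs_section_def
proof (intro conjI ballI allI impI)
  have fin': "\<not> at_infinity (snd (\<sigma> i))" if "i \<in> S" for i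
    using fin[OF that] by (auto simp: at_infinity_def)
  have mem: "fst (\<sigma> i) \<in> lines (f i)" "\<tau> i \<in> Lambda2 (f i)" if i: "i \<in> S" for i
  proof -
    show "fst (\<sigma> i) \<in> lines (f i)" using par i by (auto simp: parallel_def mem_Times_iff)
    have "snd (\<sigma> i) \<in> lines (potentials (f i))" using par i by (auto simp: parallel_def mem_Times_iff)
    then show "\<tau> i \<in> Lambda2 (f i)" using line_subset[OF _ subspace_potentials] fin[OF i] by blast
  qed
  show "fst (\<sigma> i) \<in> lines (f i)" "\<tau> i \<in> Lambda2 (f i)" if "i \<in> S" for i
    using mem that by auto
  fix i j assume e: "edge S i j"
  note ij = edge_in[OF e]
  show ni: "\<not> fst (\<sigma> i) \<subseteq> f j" by (rule parallel_line_not_in_neighbour[OF par fin' e])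
  have nj: "\<not> fst (\<sigma> j) \<subseteq> f i" by (rule parallel_line_not_in_neighbour[OF par fin' edge_sym[OF e]])
  obtain x where x: "fst (\<sigma> i) = span {x}" "x \<in> f i" using mem(1)[of i] ij by (auto simp: lines_def)
  obtain y where y: "fst (\<sigma> j) = span {y}" "y \<in> f j" using mem(1)[of j] ij by (auto simp: lines_def)
  obtain e' where e': "e' \<noteq> 0" "f i \<inter> f j = span {e'}" using edge_meet[OF e] by metis
  have span_e': "span {e'} \<subseteq> f i" "span {e'} \<subseteq> f j" using e'(2) by auto
  have nx: "x \<notin> span {e'}"
    using ni x(1) span_e' plane_subspace[of j] ij span_minimal[of "{x}" "f j"] by blast
  have ny: "y \<notin> span {e'}"
    using nj y(1) span_e' plane_subspace[of i] ij span_minimal[of "{y}" "f i"] by blast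
  note planes = edge_frame[OF e e'(2,1) x(2) nx y(2) ny]
  obtain p q r where r: "r \<noteq> 0" and form: "\<eta> j i = p *\<^sub>R (ext_of e' * ext_of x)
    + q *\<^sub>R (ext_of e' * ext_of y) + r *\<^sub>R (ext_of x * ext_of y)"
    using form_coefficients[OF e e'(2,1) x(2) nx y(2) ny] by metis
  obtain c where c: "\<tau> j = c *\<^sub>R (ext_of e' * ext_of y)"
    using mem(2)[of j] ij by (auto simp: planes(2) Lambda2_plane span_singleton)
  obtain d where d: "\<tau> i = d *\<^sub>R (ext_of e' * ext_of x)"
    using mem(2)[of i] ij by (auto simp: planes(1) Lambda2_plane span_singleton)
  have ne: "ext_of e' * (ext_of x * ext_of y) \<noteq> 0" using planes(4) by (simp add: mult.assoc)
  have "snd (\<sigma> j) = potentials_of (f j) (\<eta> j i) (fst (\<sigma> i))"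
    using par e by (auto simp: parallel_def step_def split_beta)
  then have "ext_of x * (\<eta> j i + \<tau> j) = 0"
    using fin[of j] ij by (auto simp: potentials_of_def x(1) ball_line_iff)
  moreover have "ext_of x * (\<eta> j i + \<tau> j) = - (q + c) *\<^sub>R (ext_of e' * (ext_of x * ext_of y))"
    by (simp add: form c ext_simps ext_of_left_anticommute[of x e'])
  ultimately have c': "c = - q" using ne by auto
  have "fst (\<sigma> j) = vectors_of (f j) (\<eta> i j) (snd (\<sigma> i))"
    using par e by (auto simp: parallel_def step_def split_beta)
  then have "y \<in> vectors_of (f j) (\<eta> i j) (snd (\<sigma> i))"
    using y(1) span_base by blast
  then have "ext_of y * (\<eta> i j + \<tau> i) = 0"
    using fin[of i] ij by (fastforce simp: vectors_of_def)
  moreover have "ext_of y * (\<eta> i j + \<tau> i) = (d - p) *\<^sub>R (ext_of e' * (ext_of x * ext_of y))"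
    by (simp add: form_skew[OF e] form d ext_simps ext_of_left_anticommute[of y e']
        ext_of_anticommute[of y x] ext_of_left_anticommute[of y x] ext_of_square_left)
  ultimately have d': "d = p" using ne by auto
  have net_form: "\<eta> j i + diff_form \<tau> j i = r *\<^sub>R (ext_of x * ext_of y)"
    by (simp add: diff_form_def form c c' d d')
  show "\<eta> j i + diff_form \<tau> j i \<noteq> 0" unfolding net_form using r ne by auto
  show "\<eta> j i + diff_form \<tau> j i \<in> ext_sub (fst (\<sigma> j)) \<and>\<^sub>s ext_sub (fst (\<sigma> i))"
    unfolding net_form x(1) y(1) wedge_lines ext_of_anticommute[of x y]
    by (simp add: span_base span_scale span_neg)
qed

text \<open>The initial lines are spanned by \<open>a + r b\<close> and \<open>(1, r (a \<and> b))\<close>, so different parameters \<open>r\<close> differ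
  in both components. The transport exchanges the two components along an edge and is injective on each
  of them; hence being different in both components propagates to every vertex, whereas being different
  in one of them alone would turn into a difference of the other one.\<close>

lemma koenigs_sections_exist:
  assumes S: "simply_connected_domain S"
  obtains s \<tau> s' \<tau>' where "koenigs_section s \<tau>" "koenigs_section s' \<tau>'"
    "\<And>i. i \<in> S \<Longrightarrow> s i \<noteq> s' i" "\<And>i. i \<in> S \<Longrightarrow> \<tau> i \<noteq> \<tau>' i"
proof (cases "S = {}")
  case True
  then have "koenigs_section s \<tau>" for s \<tau> unfolding koenigs_section_def edge_def by blast
  then show ?thesis using that True by blast
next
  case False
  then obtain i0 where i0: "i0 \<in> S" by blast
  obtain a b where ab: "f i0 = span {a, b}" "ext_of a * ext_of b \<noteq> 0"
    using Grassmannian_2_E[OF plane[OF i0]] by metis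
  define L where "L r = span {a + r *\<^sub>R b}" for r
  define T where "T r = span {(1::real, r *\<^sub>R (ext_of a * ext_of b))}" for r
  have wedge_ab: "ext_of (a + r *\<^sub>R b) * ext_of (a + r' *\<^sub>R b) = (r' - r) *\<^sub>R (ext_of a * ext_of b)"
    for r r'
    by (simp add: ext_simps ext_of_anticommute[of b a])
  have L: "L r \<in> lines (f i0)" for r
  proof -
    have "a + r *\<^sub>R b \<noteq> 0" using wedge_ab[of r "r + 1"] ab(2) by auto
    moreover have "a + r *\<^sub>R b \<in> f i0" by (simp add: ab span_base span_add span_scale)
    ultimately show ?thesis by (auto simp: lines_def L_def)
  qed
  have T: "T r \<in> lines (potentials (f i0))" for r
  proof -
    have "(1, r *\<^sub>R (ext_of a * ext_of b)) \<in> potentials (f i0)"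
      by (simp add: ab Lambda2_plane span_base span_scale)
    then show ?thesis unfolding lines_def T_def by (force simp: zero_prod_def)
  qed
  have L_inj: "L r \<noteq> L r'" if "r \<noteq> r'" for r r'
  proof
    assume "L r = L r'"
    then have "a + r *\<^sub>R b \<in> span {a + r' *\<^sub>R b}" unfolding L_def by (metis span_base insertI1)
    then obtain k where "a + r *\<^sub>R b = k *\<^sub>R (a + r' *\<^sub>R b)" by (auto simp: span_singleton)
    then have "ext_of (a + r *\<^sub>R b) * ext_of (a + r' *\<^sub>R b) = 0"
      by (simp only: ext_of_scale ext_of_square mult_scaleR_left scaleR_zero_right)
    then show False using wedge_ab that ab(2) by simp
  qed
  have T_inj: "T r \<noteq> T r'" if "r \<noteq> r'" for r r'
  proof
    assume "T r = T r'"
    then have "(1, r *\<^sub>R (ext_of a * ext_of b)) \<in> span {(1::real, r' *\<^sub>R (ext_of a * ext_of b))}"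
      unfolding T_def by (metis span_base insertI1)
    then show False using that ab(2) by (auto simp: span_singleton)
  qed
  have "\<exists>\<sigma>. parallel \<sigma> \<and> \<sigma> i0 = (L r, T r)" for r
  proof -
    have "(L r, T r) \<in> lines (f i0) \<times> lines (potentials (f i0))" using L T by simp
    from parallel_section_exists[OF S i0 this] show ?thesis unfolding parallel_def by metis
  qed
  then obtain \<Phi> where \<Phi>: "\<And>r. parallel (\<Phi> r)" "\<And>r. \<Phi> r i0 = (L r, T r)" by metis
  have separated: "fst (\<Phi> r i) \<noteq> fst (\<Phi> r' i) \<and> snd (\<Phi> r i) \<noteq> snd (\<Phi> r' i)"
    if "r \<noteq> r'" "i \<in> S" for r r' i
  proof (rule connected_induct[OF S i0 _ \<open>i \<in> S\<close>])
    show "fst (\<Phi> r i0) \<noteq> fst (\<Phi> r' i0) \<and> snd (\<Phi> r i0) \<noteq> snd (\<Phi> r' i0)"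
      using L_inj T_inj \<open>r \<noteq> r'\<close> by (simp add: \<Phi>)
    fix i j assume e: "edge S i j"
      and ih: "fst (\<Phi> r i) \<noteq> fst (\<Phi> r' i) \<and> snd (\<Phi> r i) \<noteq> snd (\<Phi> r' i)"
    have "fst (\<Phi> r i) = vectors_of (f i) (\<eta> j i) (snd (\<Phi> r j))"
      "snd (\<Phi> r i) = potentials_of (f i) (\<eta> i j) (fst (\<Phi> r j))" for r
      using \<Phi>(1)[of r] edge_sym[OF e] by (auto simp: parallel_def step_def split_beta)
    then show "fst (\<Phi> r j) \<noteq> fst (\<Phi> r' j) \<and> snd (\<Phi> r j) \<noteq> snd (\<Phi> r' j)"
      using ih by metis
  qed
  \<comment> \<open>Parameters whose section runs into infinity at some vertex: at most one for each vertex.\<close>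
  define bad where "bad = (\<Union>i\<in>S. {r. at_infinity (snd (\<Phi> r i))})"
  have "countable {r. at_infinity (snd (\<Phi> r i))}" if i: "i \<in> S" for i
  proof -
    have "r = r'" if "at_infinity (snd (\<Phi> r i))" "at_infinity (snd (\<Phi> r' i))" for r r'
    proof -
      have "snd (\<Phi> r i) = snd (\<Phi> r' i)"
        using at_infinity_unique[OF plane[OF i]] \<Phi>(1) i that
        by (auto simp: parallel_def mem_Times_iff)
      then show ?thesis using separated[OF _ i] by metis
    qed
    then have "\<exists>r0. {r. at_infinity (snd (\<Phi> r i))} \<subseteq> {r0}" by blast
    then show ?thesis by (metis countable_empty countable_insert countable_subset)
  qed
  then have bad: "countable bad" unfolding bad_def by (intro countable_UN) auto
  then obtain r where r: "r \<notin> bad"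
    using uncountable_UNIV_real by (metis UNIV_eq_I)
  have "countable (insert r bad)" using bad by simp
  then obtain r' where r': "r' \<notin> insert r bad"
    using uncountable_UNIV_real by (metis UNIV_eq_I)
  have good: "\<exists>\<tau>. \<forall>i\<in>S. (1, \<tau> i) \<in> snd (\<Phi> r i)" if "r \<notin> bad" for r
    using that unfolding bad_def at_infinity_def by (intro bchoice) auto
  obtain \<tau> where \<tau>: "\<And>i. i \<in> S \<Longrightarrow> (1, \<tau> i) \<in> snd (\<Phi> r i)" using good r by blast
  obtain \<tau>' where \<tau>': "\<And>i. i \<in> S \<Longrightarrow> (1, \<tau>' i) \<in> snd (\<Phi> r' i)" using good r' by blast
  show ?thesis
  proof (rule that[OF koenigs_section_of_parallel[OF \<Phi>(1) \<tau>] koenigs_section_of_parallel[OF \<Phi>(1) \<tau>']])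
    fix i assume i: "i \<in> S"
    show "fst (\<Phi> r i) \<noteq> fst (\<Phi> r' i)" using separated[OF _ i] r' by auto
    have line: "snd (\<Phi> r i) = span {(1, \<tau>)}" if "(1, \<tau>) \<in> snd (\<Phi> r i)" for r \<tau>
    proof -
      have "snd (\<Phi> r i) \<in> lines (potentials (f i))"
        using \<Phi>(1) i by (auto simp: parallel_def mem_Times_iff)
      then obtain w where "snd (\<Phi> r i) = span {w}" by (auto simp: lines_def)
      then show ?thesis using span_singleton_eq[of "(1, \<tau>)" w] that by (auto simp: zero_prod_def)
    qed
    show "\<tau> i \<noteq> \<tau>' i"
      using line[OF \<tau>[OF i]] line[OF \<tau>'[OF i]] separated[of r r' i] i r' by auto
  qed
qed

lemma koenigs_section_adjacent:
  assumes "koenigs_section s \<tau>" "koenigs_section s' \<tau>'" "edge S i j"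
  shows "s i \<noteq> s' j"
proof -
  have "s' j \<subseteq> f j"
    using assms(2) edge_in[OF assms(3)] line_subset plane_subspace by (auto simp: koenigs_section_def)
  moreover have "\<not> s i \<subseteq> f j"
    using assms(1,3) unfolding koenigs_section_def by blast
  ultimately show ?thesis by blast
qed

lemma koenigs_section_net:
  assumes sec: "koenigs_section s \<tau>"
  shows "koenigs_net S s (\<lambda>j i. \<eta> j i + diff_form \<tau> j i)"
proof -
  have lines: "s i \<in> lines (f i)" "s i \<in> Grassmannian 1" if "i \<in> S" for i
    using sec that line_in_Grassmannian by (auto simp: koenigs_section_def)
  have wedge: "\<exists>x y z. x \<in> s i \<and> y \<in> s j \<and> z \<in> s k \<and> ext_of x * ext_of y * ext_of z \<noteq> 0"
    if q: "quad S i j k l" for i j k l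
  proof -
    note edges = quad_edges[OF q]
    have "\<exists>x. x \<in> s i \<and> x \<in> f i \<and> x \<notin> f j" if "edge S i j" for i j
      using sec that line_subset[OF lines(1) plane_subspace, of i] edge_in[OF that]
      unfolding koenigs_section_def by blast
    then show ?thesis
      using quad_section_independent[OF q] edges(1,2) edge_sym[OF edges(2)] by meson
  qed
  have opposite: "s i \<noteq> s k" if q: "quad S i j k l" for i j k l
  proof
    assume eq: "s i = s k"
    obtain x y z where xyz: "x \<in> s i" "y \<in> s j" "z \<in> s k" "ext_of x * ext_of y * ext_of z \<noteq> 0"
      using wedge[OF q] by blast
    obtain w where w: "s i = span {w}"
      using lines(1) quad_edges[OF q] edge_in by (metis Grassmannian_1_E lines(2))
    have "z \<in> span {x}"
      using xyz eq w span_singleton_eq[OF wedge3_neq_0_D(1)[OF xyz(4)]] by auto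
    then have "z \<in> span {x, y}" using span_mono[of "{x}" "{x, y}"] by auto
    then show False using wedge3_neq_0_D(3)[OF xyz(4)] by blast
  qed
  have "regular_map S s"
    unfolding regular_map_def
  proof (intro conjI ballI allI impI)
    show "s i \<in> Grassmannian 1" if "i \<in> S" for i using lines that by blast
    fix i j k l assume q: "quad S i j k l"
    note edges = quad_edges[OF q]
    show "distinct [s i, s j, s k, s l]"
      using opposite[OF q] opposite[OF quad_rotate[OF q]] koenigs_section_adjacent[OF sec sec] edges
        edge_sym[OF edges(4)] by auto
    obtain x y z where "x \<in> s i" "y \<in> s j" "z \<in> s k" "ext_of x * ext_of y * ext_of z \<noteq> 0"
      using wedge[OF q] by blast
    then show "3 \<le> dim (span (s i \<union> s j \<union> s k \<union> s l))"
      using edges[THEN edge_in] by (intro dim_lines_ge_3[of _ _ _ _ x y z] lines) auto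
  qed
  moreover have "one_form S (Lambda2 UNIV) (\<lambda>j i. \<eta> j i + diff_form \<tau> j i)"
    unfolding one_form_def
  proof (intro allI impI conjI)
    fix i j assume e: "edge S i j"
    have "Lambda2 (f i) \<subseteq> Lambda2 UNIV" for i by (rule Lambda2_mono) simp
    then have "\<tau> i \<in> Lambda2 UNIV" "\<tau> j \<in> Lambda2 UNIV"
      using sec edge_in[OF e] by (auto simp: koenigs_section_def)
    moreover have "\<eta> j i \<in> Lambda2 UNIV"
      using applicable e unfolding applicable_via_def one_form_def by blast
    ultimately show "\<eta> j i + diff_form \<tau> j i \<in> Lambda2 UNIV"
      by (simp add: diff_form_def subspace_Lambda2 subspace_add subspace_diff)
    show "\<eta> j i + diff_form \<tau> j i = - (\<eta> i j + diff_form \<tau> i j)"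
      by (simp add: form_skew[OF e] diff_form_def)
  qed
  moreover have "closed_form S (\<lambda>j i. \<eta> j i + diff_form \<tau> j i)"
    unfolding closed_form_def
  proof (intro allI impI)
    fix i j k l assume "quad S i j k l"
    from form_closed[OF this] show "\<eta> i l + diff_form \<tau> i l + (\<eta> l k + diff_form \<tau> l k) +
      (\<eta> k j + diff_form \<tau> k j) + (\<eta> j i + diff_form \<tau> j i) = 0"
      by (simp add: diff_form_def algebra_simps)
  qed
  ultimately show ?thesis
    using sec by (simp add: koenigs_net_def koenigs_section_def)
qed

end

section \<open>The doubled lattice domain\<close>

lemma lift_pt_None [simp]: "lift_pt e x $ None = e"
  and lift_pt_Some [simp]: "lift_pt e x $ Some m = x $ m"
  by (simp_all add: lift_pt_def)

lemma base_pt_lift_pt [simp]: "base_pt (lift_pt e x) = x"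
  by (simp add: base_pt_def vec_eq_iff)

lemma lift_pt_eq_iff [simp]: "lift_pt e x = lift_pt e' x' \<longleftrightarrow> e = e' \<and> x = x'"
  by (metis base_pt_lift_pt lift_pt_None)

lemma join_maps_lift_pt [simp]: "join_maps s s' (lift_pt e x) = (if e = 0 then s x else s' x)"
  by (simp add: join_maps_def)

lemma lift_pt_in_double [simp]: "lift_pt e x \<in> double S \<longleftrightarrow> e \<in> {0, 1} \<and> x \<in> S"
  by (auto simp: double_def)

lemma double_E:
  assumes "y \<in> double S"
  obtains e x where "y = lift_pt e x"
  using assms by (auto simp: double_def)

lemma lift_pt_add_axis:
  "lift_pt e x + axis None c = lift_pt (e + c) x"
  "lift_pt e x + axis (Some m) c = lift_pt e (x + axis m c)"
proof -
  have "(lift_pt e x + axis None c) $ k = lift_pt (e + c) x $ k" for k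
    by (cases k) (simp_all add: axis_def)
  then show "lift_pt e x + axis None c = lift_pt (e + c) x" by (simp add: vec_eq_iff)
  have "(lift_pt e x + axis (Some m) c) $ k = lift_pt e (x + axis m c) $ k" for k
    by (cases k) (simp_all add: axis_def)
  then show "lift_pt e x + axis (Some m) c = lift_pt e (x + axis m c)" by (simp add: vec_eq_iff)
qed

lemma uminus_axis: "- axis m (1::int) = axis m (- 1)"
  by (simp add: axis_def vec_eq_iff)

lemma edge_neq: "edge S i j \<Longrightarrow> i \<noteq> j"
  by (auto simp: edge_def axis_eq_0_iff)

lemma edge_double_iff:
  "edge (double S) (lift_pt e i) (lift_pt e' j) \<longleftrightarrow>
     e \<in> {0, 1} \<and> e' \<in> {0, 1} \<and> (if e = e' then edge S i j else i = j \<and> i \<in> S)"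
proof -
  have "(\<exists>m. lift_pt e' j = lift_pt e i + axis m 1 \<or> lift_pt e i = lift_pt e' j + axis m 1) \<longleftrightarrow>
      (i = j \<and> (e' = e + 1 \<or> e = e' + 1)) \<or> (e = e' \<and> (\<exists>m. j = i + axis m 1 \<or> i = j + axis m 1))"
    by (auto simp: split_option_ex lift_pt_add_axis)
  then show ?thesis unfolding edge_def by auto
qed

text \<open>A quadrilateral of the doubled domain lies in one of the two layers or stands on an edge. In the
  second case either the first or the last of its sides, in the given cyclic order, can be horizontal.\<close>

lemma quad_double:
  assumes "quad (double S) y1 y2 y3 y4"
  obtains (horizontal) e i j k l where "e \<in> {0, 1}" "quad S i j k l" "y1 = lift_pt e i"
      "y2 = lift_pt e j" "y3 = lift_pt e k" "y4 = lift_pt e l"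
  | (vertical) e e' i j where "e \<in> {0, 1}" "e' \<in> {0, 1}" "e \<noteq> e'" "edge S i j" "y1 = lift_pt e i"
      "y2 = lift_pt e j" "y3 = lift_pt e' j" "y4 = lift_pt e' i"
  | (vertical') e e' i j where "e \<in> {0, 1}" "e' \<in> {0, 1}" "e \<noteq> e'" "edge S i j" "y1 = lift_pt e i"
      "y2 = lift_pt e' i" "y3 = lift_pt e' j" "y4 = lift_pt e j"
proof -
  obtain a b u v where ab: "a \<noteq> b"
    and uv: "u \<in> {axis a 1, - axis a 1}" "v \<in> {axis b 1, - axis b 1}"
    and y: "y2 = y1 + u" "y3 = y1 + u + v" "y4 = y1 + v"
    using assms unfolding quad_def by blast
  have mem: "y1 \<in> double S" "y2 \<in> double S" "y3 \<in> double S" "y4 \<in> double S"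
    using assms by (auto simp: quad_def)
  obtain e i where y1: "y1 = lift_pt e i" using double_E[OF mem(1)] by metis
  obtain c where c: "u = axis a c" "c \<in> {1, - 1}" using uv(1) by (auto simp: uminus_axis)
  obtain d where d: "v = axis b d" "d \<in> {1, - 1}" using uv(2) by (auto simp: uminus_axis)
  have edge_axis: "edge S i (i + axis m t)" if "i \<in> S" "i + axis m t \<in> S" "t \<in> {1, - 1}" for m t
  proof -
    have "i = i + axis m (- 1) + axis m 1" by (simp add: axis_def vec_eq_iff)
    then show ?thesis using that by (auto simp: edge_def)
  qed
  show ?thesis
  proof (cases a; cases b)
    fix a' b' assume Some: "a = Some a'" "b = Some b'"
    then have y': "y2 = lift_pt e (i + axis a' c)" "y3 = lift_pt e (i + axis a' c + axis b' d)"
      "y4 = lift_pt e (i + axis b' d)"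
      by (simp_all add: y y1 c d lift_pt_add_axis)
    have "axis a' c \<in> {axis a' 1, - axis a' 1}" "axis b' d \<in> {axis b' 1, - axis b' 1}" "a' \<noteq> b'"
      using c d ab Some by (auto simp: uminus_axis)
    then have "quad S i (i + axis a' c) (i + axis a' c + axis b' d) (i + axis b' d)"
      using mem unfolding y1 y' lift_pt_in_double quad_def by blast
    then show thesis using horizontal[OF _ _ y1 y'] mem by (simp add: y1)
  next
    fix a' assume Some: "a = Some a'" "b = None"
    then have y': "y2 = lift_pt e (i + axis a' c)" "y3 = lift_pt (e + d) (i + axis a' c)"
      "y4 = lift_pt (e + d) i"
      by (simp_all add: y y1 c d lift_pt_add_axis)
    show thesis
      by (rule vertical[OF _ _ _ edge_axis y1 y'])
        (use mem c d in \<open>auto simp: y1 y'\<close>)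
  next
    fix b' assume Some: "a = None" "b = Some b'"
    then have y': "y2 = lift_pt (e + c) i" "y3 = lift_pt (e + c) (i + axis b' d)"
      "y4 = lift_pt e (i + axis b' d)"
      by (simp_all add: y y1 c d lift_pt_add_axis)
    show thesis
      by (rule vertical'[OF _ _ _ edge_axis y1 y'])
        (use mem c d in \<open>auto simp: y1 y'\<close>)
  next
    assume "a = None" "b = None"
    then show thesis using ab by simp
  qed
qed

lemma quad_double_vertical:
  assumes "edge S i j"
  shows "quad (double S) (lift_pt 0 i) (lift_pt 0 j) (lift_pt 1 j) (lift_pt 1 i)"
proof -
  obtain m where m: "j = i + axis m 1 \<or> i = j + axis m 1" using assms by (auto simp: edge_def)
  obtain c where c: "j = i + axis m c" "c \<in> {1, - 1}"
  proof (cases "j = i + axis m 1")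
    case False
    then have "j = i + axis m (- 1)" using m by (simp flip: uminus_axis)
    then show ?thesis using that by blast
  qed (use that in blast)
  have "axis (Some m) c \<in> {axis (Some m) 1, - axis (Some m) (1::int)}"
    using c(2) by (auto simp: uminus_axis)
  moreover have "lift_pt 0 j = lift_pt 0 i + axis (Some m) c"
    "lift_pt 1 j = lift_pt 0 i + axis (Some m) c + axis None 1" "lift_pt 1 i = lift_pt 0 i + axis None 1"
    by (simp_all add: c(1) lift_pt_add_axis)
  moreover have "lift_pt 0 i \<in> double S" "lift_pt 0 j \<in> double S" "lift_pt 1 j \<in> double S"
    "lift_pt 1 i \<in> double S" using edge_in[OF assms] by simp_all
  ultimately show ?thesis unfolding quad_def
    by (intro conjI exI[of _ "Some m"] exI[of _ None] exI[of _ "axis (Some m) c"] exI[of _ "axis None 1"])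
      simp_all
qed

section \<open>From applicability to a Koenigs--Moutard pair\<close>

context applicable_congruence
begin

text \<open>The form on the doubled domain is the pullback of \<open>\<eta>\<close> plus the differential of the function that
  is \<open>\<tau>\<close> on one layer and \<open>\<tau>'\<close> on the other, so it is closed without further computation.\<close>

lemma koenigs_sections_moutard_pair:
  assumes sec: "koenigs_section s \<tau>" and sec': "koenigs_section s' \<tau>'"
    and ne: "\<And>i. i \<in> S \<Longrightarrow> s i \<noteq> s' i" "\<And>i. i \<in> S \<Longrightarrow> \<tau> i \<noteq> \<tau>' i"
  shows "koenigs_moutard_pair S s (\<lambda>j i. \<eta> j i + diff_form \<tau> j i)
      s' (\<lambda>j i. \<eta> j i + diff_form \<tau>' j i)"
    and "spanned_by S f s s'"
proof -
  note net = koenigs_section_net[OF sec] and net' = koenigs_section_net[OF sec']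
  have lines: "s i \<in> lines (f i)" "s' i \<in> lines (f i)" "s i \<in> Grassmannian 1" "s' i \<in> Grassmannian 1"
    and \<tau>: "\<tau> i \<in> Lambda2 (f i)" "\<tau>' i \<in> Lambda2 (f i)" if "i \<in> S" for i
    using sec sec' that line_in_Grassmannian unfolding koenigs_section_def by blast+
  have gens: "\<exists>x x'. s i = span {x} \<and> s' i = span {x'} \<and> x \<in> f i \<and> x' \<in> f i \<and> x \<noteq> 0 \<and>
      x' \<notin> span {x} \<and> f i = span {x, x'}" if i: "i \<in> S" for i
  proof -
    obtain x x' where x: "s i = span {x}" "x \<in> f i" "x \<noteq> 0" "s' i = span {x'}" "x' \<in> f i" "x' \<noteq> 0"
      using lines[OF i] by (auto simp: lines_def)
    have "x' \<notin> span {x}" using ne(1)[OF i] span_singleton_eq[OF x(6)] x by metis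
    then show ?thesis using x plane_eq_span[OF plane[OF i]] by blast
  qed
  show "spanned_by S f s s'"
    unfolding spanned_by_def
  proof (intro ballI conjI)
    fix i assume i: "i \<in> S"
    obtain x x' where x: "s i = span {x}" "s' i = span {x'}" "x \<in> f i" "x' \<in> f i" "x \<noteq> 0"
      "x' \<notin> span {x}" "f i = span {x, x'}" using gens[OF i] by blast
    show "s i \<subseteq> f i" "s' i \<subseteq> f i" unfolding x(1,2,7) by (auto intro!: span_mono)
    show "span (s i \<union> s' i) = f i"
      unfolding x(1,2,7) span_span_Un by (simp add: insert_commute)
    have "z = 0" if z: "z \<in> span {x}" "z \<in> span {x'}" for z
    proof (rule ccontr)
      assume "z \<noteq> 0"
      then have "span {x} = span {x'}" using span_singleton_eq z by metis
      then show False using x(6) span_base by blast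
    qed
    then show "s i \<inter> s' i = {0}" by (auto simp: x(1,2) span_zero)
  qed
  define U where "U = join_maps s s'"
  define T where "T = join_maps \<tau> \<tau>'"
  \<comment> \<open>On a vertical edge both base points agree, and the pullback of \<open>\<eta>\<close> is zero.\<close>
  define H where "H y z = (if base_pt y = base_pt z then 0 else \<eta> (base_pt y) (base_pt z)) + T y - T z"
    for y z
  have H_edge: "H (lift_pt e j) (lift_pt e i) =
      (if e = 0 then \<eta> j i + diff_form \<tau> j i else \<eta> j i + diff_form \<tau>' j i)"
    if "edge S i j" for e i j
    using edge_neq[OF that] by (auto simp: H_def T_def diff_form_def)
  have H_vertical: "H (lift_pt e i) (lift_pt e' i) = T (lift_pt e i) - T (lift_pt e' i)" for e e' i
    by (simp add: H_def)
  have T_in: "T (lift_pt e i) \<in> Lambda2 (f i)" if "i \<in> S" for e i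
    using \<tau>[OF that] by (simp add: T_def)
  have vertical_lines: "ext_sub (U (lift_pt e i)) \<and>\<^sub>s ext_sub (U (lift_pt e' i)) = Lambda2 (f i)"
    if "i \<in> S" "e \<in> {0, 1}" "e' \<in> {0, 1}" "e \<noteq> e'" for e e' i
  proof -
    note i = that(1)
    obtain x x' where x: "s i = span {x}" "s' i = span {x'}" "f i = span {x, x'}"
      using gens[OF i] by blast
    have "span {ext_of x' * ext_of x} = Lambda2 (span {x', x})" by (simp only: Lambda2_plane)
    then show ?thesis
      using \<open>e \<in> _\<close> \<open>e' \<in> _\<close> \<open>e \<noteq> e'\<close>
      by (auto simp: U_def x wedge_lines Lambda2_plane insert_commute[of x' x])
  qed
  have adjacent: "U (lift_pt e i) \<noteq> U (lift_pt e' j)" if "edge S i j" for e e' i j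
    using koenigs_section_adjacent[OF sec sec that] koenigs_section_adjacent[OF sec sec' that]
      koenigs_section_adjacent[OF sec' sec that] koenigs_section_adjacent[OF sec' sec' that]
    by (simp add: U_def)
  have vertical_neq: "U (lift_pt e i) \<noteq> U (lift_pt e' i)"
    if "i \<in> S" "e \<in> {0, 1}" "e' \<in> {0, 1}" "e \<noteq> e'" for e e' i
    using ne(1)[OF that(1)] that(2-4) by (auto simp: U_def)
  have vertical_wedge: "\<exists>x y z. {x, y, z} \<subseteq> s i \<union> s' i \<union> s j \<union> s' j \<and> ext_of x * ext_of y * ext_of z \<noteq> 0"
    if e: "edge S i j" for i j
  proof -
    note ij = edge_in[OF e]
    obtain x x' where x: "s i = span {x}" "s' i = span {x'}" "x \<noteq> 0" "x' \<notin> span {x}" "f i = span {x, x'}"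
      using gens ij by metis
    obtain y where y: "s j = span {y}" using lines(1)[of j] ij by (auto simp: lines_def)
    have "y \<notin> f i"
    proof
      assume "y \<in> f i"
      then have "s j \<subseteq> f i" unfolding y using plane_subspace ij by (intro span_minimal) auto
      then show False using sec edge_sym[OF e] unfolding koenigs_section_def by blast
    qed
    then have "ext_of x * ext_of x' * ext_of y \<noteq> 0" using x by (intro wedge3_neq_0) auto
    moreover have "{x, x', y} \<subseteq> s i \<union> s' i \<union> s j \<union> s' j" by (simp add: x y span_base)
    ultimately show ?thesis by blast
  qed
  have U_line: "U (lift_pt e i) \<in> Grassmannian 1" if "i \<in> S" for e i
    using lines[OF that] by (simp add: U_def)
  have regular: "regular_map (double S) U"
    unfolding regular_map_def
  proof (intro conjI ballI allI impI)
    show "U y \<in> Grassmannian 1" if "y \<in> double S" for y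
      using that U_line by (auto simp: double_def)
    fix y1 y2 y3 y4 assume "quad (double S) y1 y2 y3 y4"
    then have "distinct [U y1, U y2, U y3, U y4] \<and> 3 \<le> dim (span (U y1 \<union> U y2 \<union> U y3 \<union> U y4))"
    proof (cases rule: quad_double)
      case (horizontal e i j k l)
      then show ?thesis
        using net net' unfolding koenigs_net_def regular_map_def U_def by auto
    next
      case (vertical e e' i j)
      note ij = edge_in[OF vertical(4)]
      obtain x y z where xyz: "{x, y, z} \<subseteq> s i \<union> s' i \<union> s j \<union> s' j" "ext_of x * ext_of y * ext_of z \<noteq> 0"
        using vertical_wedge[OF vertical(4)] by blast
      have "{x, y, z} \<subseteq> U y1 \<union> U y2 \<union> U y3 \<union> U y4"
        using xyz(1) vertical by (auto simp: U_def)
      then have "3 \<le> dim (span (U y1 \<union> U y2 \<union> U y3 \<union> U y4))"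
        by (intro dim_lines_ge_3[OF _ _ _ _ xyz(2)]) (use U_line ij vertical in auto)
      moreover have "distinct [U y1, U y2, U y3, U y4]"
        using adjacent[OF vertical(4)] adjacent[OF edge_sym[OF vertical(4)]] vertical_neq ij vertical(1-3)
        unfolding vertical by simp
      ultimately show ?thesis by blast
    next
      case (vertical' e e' i j)
      note ij = edge_in[OF vertical'(4)]
      obtain x y z where xyz: "{x, y, z} \<subseteq> s i \<union> s' i \<union> s j \<union> s' j" "ext_of x * ext_of y * ext_of z \<noteq> 0"
        using vertical_wedge[OF vertical'(4)] by blast
      have "{x, y, z} \<subseteq> U y1 \<union> U y2 \<union> U y3 \<union> U y4"
        using xyz(1) vertical' by (auto simp: U_def)
      then have "3 \<le> dim (span (U y1 \<union> U y2 \<union> U y3 \<union> U y4))"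
        by (intro dim_lines_ge_3[OF _ _ _ _ xyz(2)]) (use U_line ij vertical' in auto)
      moreover have "distinct [U y1, U y2, U y3, U y4]"
        using adjacent[OF vertical'(4)] adjacent[OF edge_sym[OF vertical'(4)]] vertical_neq ij vertical'(1-3)
        unfolding vertical' by simp
      ultimately show ?thesis by blast
    qed
    then show "distinct [U y1, U y2, U y3, U y4]" "3 \<le> dim (span (U y1 \<union> U y2 \<union> U y3 \<union> U y4))"
      by blast+
  qed
  have edge_cases: "\<exists>e e' i j. y = lift_pt e i \<and> z = lift_pt e' j \<and> e \<in> {0, 1} \<and> e' \<in> {0, 1} \<and>
      (e = e' \<and> edge S i j \<or> e \<noteq> e' \<and> i = j \<and> i \<in> S)" if "edge (double S) y z" for y z
  proof -
    note yz = that
    obtain e i e' j where "y = lift_pt e i" "z = lift_pt e' j"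
      using edge_in[OF yz] double_E by metis
    then show ?thesis using yz by (auto simp: edge_double_iff split: if_splits)
  qed
  have "one_form (double S) (Lambda2 UNIV) H"
    unfolding one_form_def
  proof (intro allI impI)
    fix y z assume "edge (double S) y z"
    then obtain e e' i j where yz: "y = lift_pt e i" "z = lift_pt e' j" "e \<in> {0, 1}" "e' \<in> {0, 1}"
      and cases: "e = e' \<and> edge S i j \<or> e \<noteq> e' \<and> i = j \<and> i \<in> S" using edge_cases by blast
    from cases show "H z y \<in> Lambda2 UNIV \<and> H z y = - H y z"
    proof (elim disjE conjE)
      assume e: "e = e'" "edge S i j"
      have "\<eta> j i + diff_form \<tau> j i \<in> Lambda2 UNIV \<and>
          \<eta> j i + diff_form \<tau> j i = - (\<eta> i j + diff_form \<tau> i j)"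
        "\<eta> j i + diff_form \<tau>' j i \<in> Lambda2 UNIV \<and>
          \<eta> j i + diff_form \<tau>' j i = - (\<eta> i j + diff_form \<tau>' i j)"
        using net net' e(2) unfolding koenigs_net_def one_form_def by blast+
      then show ?thesis
        unfolding yz e(1) H_edge[OF e(2)] H_edge[OF edge_sym[OF e(2)]]
        by metis
    next
      assume e: "e \<noteq> e'" "i = j" "i \<in> S"
      have "T (lift_pt e' i) - T (lift_pt e i) \<in> Lambda2 (f i)"
        using T_in[OF e(3)] by (simp add: subspace_diff subspace_Lambda2)
      then show ?thesis
        using Lambda2_mono[of "f i" UNIV] unfolding yz e(2)[symmetric] H_vertical by auto
    qed
  qed
  moreover have "closed_form (double S) H"
    unfolding closed_form_def
  proof (intro allI impI)
    fix y1 y2 y3 y4 assume "quad (double S) y1 y2 y3 y4"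
    then show "H y1 y4 + H y4 y3 + H y3 y2 + H y2 y1 = 0"
    proof (cases rule: quad_double)
      case (horizontal e i j k l)
      show ?thesis
        using form_closed[OF horizontal(2)] quad_edges[OF horizontal(2), THEN edge_neq]
        unfolding horizontal by (simp add: H_def algebra_simps)
    next
      case (vertical e e' i j)
      show ?thesis
        using edge_neq[OF vertical(4)] form_skew[OF vertical(4)] unfolding vertical by (simp add: H_def)
    next
      case (vertical' e e' i j)
      show ?thesis
        using edge_neq[OF vertical'(4)] form_skew[OF vertical'(4)] unfolding vertical' by (simp add: H_def)
    qed
  qed
  moreover have "\<forall>y z. edge (double S) y z \<longrightarrow> H z y \<noteq> 0 \<and> H z y \<in> ext_sub (U z) \<and>\<^sub>s ext_sub (U y)"
  proof (intro allI impI)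
    fix y z assume "edge (double S) y z"
    then obtain e e' i j where yz: "y = lift_pt e i" "z = lift_pt e' j" "e \<in> {0, 1}" "e' \<in> {0, 1}"
      and cases: "e = e' \<and> edge S i j \<or> e \<noteq> e' \<and> i = j \<and> i \<in> S" using edge_cases by blast
    from cases show "H z y \<noteq> 0 \<and> H z y \<in> ext_sub (U z) \<and>\<^sub>s ext_sub (U y)"
    proof (elim disjE conjE)
      assume e: "e = e'" "edge S i j"
      show ?thesis
        using net net' e(2) unfolding yz e(1) koenigs_net_def by (simp add: H_edge U_def)
    next
      assume e: "e \<noteq> e'" "i = j" "i \<in> S"
      have "T (lift_pt e' i) - T (lift_pt e i) \<in> Lambda2 (f i)"
        using T_in[OF e(3)] by (simp add: subspace_diff subspace_Lambda2)
      moreover have "T (lift_pt e' i) \<noteq> T (lift_pt e i)"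
        using ne(2)[OF e(3)] e(1) yz(3,4) by (auto simp: T_def)
      ultimately show ?thesis
        using vertical_lines[OF e(3), of e' e] e(1) yz(3,4)
        unfolding yz(1,2) e(2)[symmetric] H_vertical by auto
    qed
  qed
  ultimately have "koenigs_net (double S) U H"
    using regular unfolding koenigs_net_def by blast
  then show "koenigs_moutard_pair S s (\<lambda>j i. \<eta> j i + diff_form \<tau> j i)
      s' (\<lambda>j i. \<eta> j i + diff_form \<tau>' j i)"
    using net net' regular H_edge unfolding koenigs_moutard_pair_def U_def by (intro conjI exI[of _ H]) auto
qed

end

section \<open>From a Koenigs--Moutard pair to applicability\<close>

lemma form_class_eq:
  assumes "\<omega> \<in> form_class S f \<eta>"
  shows "form_class S f \<eta> = form_class S f \<omega>"
proof -
  obtain \<tau> where \<tau>: "\<And>i. i \<in> S \<Longrightarrow> \<tau> i \<in> Lambda2 (f i)"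
    "\<And>i j. edge S i j \<Longrightarrow> \<omega> j i = \<eta> j i + diff_form \<tau> j i"
    using assms unfolding form_class_def by blast
  show ?thesis
  proof (intro set_eqI iffI)
    fix \<zeta> assume "\<zeta> \<in> form_class S f \<eta>"
    then obtain \<rho> where \<rho>: "\<And>i. i \<in> S \<Longrightarrow> \<rho> i \<in> Lambda2 (f i)"
      "\<And>i j. edge S i j \<Longrightarrow> \<zeta> j i = \<eta> j i + diff_form \<rho> j i"
      unfolding form_class_def by blast
    then show "\<zeta> \<in> form_class S f \<omega>"
      unfolding form_class_def using \<tau>
      by (intro CollectI exI[of _ "\<lambda>i. \<rho> i - \<tau> i"])
        (auto simp: diff_form_def subspace_diff subspace_Lambda2)
  next
    fix \<zeta> assume "\<zeta> \<in> form_class S f \<omega>"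
    then obtain \<rho> where \<rho>: "\<And>i. i \<in> S \<Longrightarrow> \<rho> i \<in> Lambda2 (f i)"
      "\<And>i j. edge S i j \<Longrightarrow> \<zeta> j i = \<omega> j i + diff_form \<rho> j i"
      unfolding form_class_def by blast
    then show "\<zeta> \<in> form_class S f \<eta>"
      unfolding form_class_def using \<tau>
      by (intro CollectI exI[of _ "\<lambda>i. \<rho> i + \<tau> i"])
        (auto simp: diff_form_def subspace_add subspace_Lambda2)
  qed
qed

lemma form_class_refl: "\<eta> \<in> form_class S f \<eta>"
  unfolding form_class_def
  by (intro CollectI exI[of _ "\<lambda>_. 0"]) (simp add: diff_form_def subspace_0 subspace_Lambda2)

lemma span_singleton_eq_0: "span {a} = {0} \<longleftrightarrow> a = 0"
  using span_base[of a "{a}"] by auto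

lemma applicable_via_form_class:
  assumes app: "applicable_via S f \<eta>" and \<omega>: "\<omega> \<in> form_class S f \<eta>"
  shows "applicable_via S f \<omega>"
proof -
  interpret applicable_congruence S f \<eta> using app by unfold_locales
  obtain \<tau> where \<tau>: "\<And>i. i \<in> S \<Longrightarrow> \<tau> i \<in> Lambda2 (f i)"
    and \<omega>': "\<And>i j. edge S i j \<Longrightarrow> \<omega> j i = \<eta> j i + diff_form \<tau> j i"
    using \<omega> unfolding form_class_def by blast
  have \<tau>_mono: "\<tau> i \<in> Lambda2 W" if "i \<in> S" "f i \<subseteq> W" for i W
    using \<tau>[OF that(1)] Lambda2_mono[OF that(2)] by blast
  have "one_form S (Lambda2 UNIV) \<omega>"
    unfolding one_form_def
  proof (intro allI impI)
    fix i j assume e: "edge S i j"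
    have "\<eta> j i \<in> Lambda2 UNIV"
      using applicable e unfolding applicable_via_def one_form_def by blast
    moreover have "\<tau> i \<in> Lambda2 UNIV" "\<tau> j \<in> Lambda2 UNIV" using \<tau>_mono edge_in[OF e] by auto
    ultimately show "\<omega> j i \<in> Lambda2 UNIV \<and> \<omega> j i = - \<omega> i j"
      by (simp add: \<omega>'[OF e] \<omega>'[OF edge_sym[OF e]] form_skew[OF e] diff_form_def subspace_Lambda2
          subspace_add subspace_diff)
  qed
  moreover have "closed_form S \<omega>"
    unfolding closed_form_def
  proof (intro allI impI)
    fix i j k l assume q: "quad S i j k l"
    note e = quad_edges[OF q]
    show "\<omega> i l + \<omega> l k + \<omega> k j + \<omega> j i = 0"
      using form_closed[OF q] by (simp add: \<omega>'[OF e(1)] \<omega>'[OF e(2)] \<omega>'[OF e(3)] \<omega>'[OF e(4)]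
          diff_form_def algebra_simps)
  qed
  moreover have "\<omega> i j \<in> Lambda2 (span (f i \<union> f j)) \<and> {\<omega> i j} \<and>\<^sub>s ext_sub (f i \<inter> f j) \<noteq> {0}"
    if "edge S i j" for i j
  proof
    note e = edge_sym[OF that] and ij = edge_in[OF that]
    have sub: "f i \<subseteq> span (f i \<union> f j)" "f j \<subseteq> span (f i \<union> f j)" by (auto intro: span_base)
    have "\<eta> i j \<in> Lambda2 (span (f i \<union> f j))"
      using form_in_Lambda2[OF e] by (simp add: Un_commute)
    then show "\<omega> i j \<in> Lambda2 (span (f i \<union> f j))"
      using \<tau>_mono ij sub by (simp add: \<omega>'[OF e] diff_form_def subspace_Lambda2 subspace_add subspace_diff)
    obtain e' where e': "e' \<noteq> 0" "f j \<inter> f i = span {e'}" using edge_meet[OF e] by metis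
    have mem: "e' \<in> f i" "e' \<in> f j" using e'(2) span_base by blast+
    have "\<omega> i j * ext_of e' = \<eta> i j * ext_of e'"
      using Lambda2_plane_annihilated(2)[OF plane mem(1) \<tau>] Lambda2_plane_annihilated(2)[OF plane mem(2) \<tau>] ij
      by (simp add: \<omega>'[OF e] diff_form_def distrib_right left_diff_distrib)
    then have "\<omega> i j * ext_of e' \<noteq> 0" using form_wedge_meet[OF e e'(2)] by simp
    then show "{\<omega> i j} \<and>\<^sub>s ext_sub (f i \<inter> f j) \<noteq> {0}"
      using e'(2) by (simp add: Int_commute wedge_singleton_line span_singleton_eq_0)
  qed
  ultimately show ?thesis using regular by (simp add: applicable_via_def)
qed

context regular_congruence
begin

text \<open>Here \<open>v\<close> is the vertical part of the form on the doubled domain. If \<open>x\<close> or \<open>y\<close>, which span the lines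
  of \<open>sp\<close>, were on the common line spanned by \<open>e\<close>, then \<open>\<eta>p \<and> e\<close> would vanish, hence also \<open>\<eta>m \<and> e\<close>. But
  the lines of \<open>sm\<close> are then different from that line, so \<open>e, x', y'\<close> are independent and
  \<open>\<eta>m \<and> e \<noteq> 0\<close>.\<close>

lemma moutard_pair_applicable:
  assumes pair: "koenigs_moutard_pair S sp \<eta>p sm \<eta>m" and spanned: "spanned_by S f sp sm"
  shows "\<eta>m \<in> form_class S f \<eta>p" and "applicable_via S f \<eta>p"
proof -
  have netp: "koenigs_net S sp \<eta>p" and netm: "koenigs_net S sm \<eta>m"
    and reg: "regular_map (double S) (join_maps sp sm)"
    using pair by (auto simp: koenigs_moutard_pair_def)
  obtain H where H: "\<And>i j. edge S i j \<Longrightarrow> H (lift_pt 0 j) (lift_pt 0 i) = \<eta>p j i"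
      "\<And>i j. edge S i j \<Longrightarrow> H (lift_pt 1 j) (lift_pt 1 i) = \<eta>m j i"
    and netH: "koenigs_net (double S) (join_maps sp sm) H"
    using pair unfolding koenigs_moutard_pair_def by blast
  define v where "v i = H (lift_pt 1 i) (lift_pt 0 i)" for i
  have sub: "sp i \<subseteq> f i" "sm i \<subseteq> f i" if "i \<in> S" for i
    using spanned that by (auto simp: spanned_by_def)
  have v: "v i \<in> Lambda2 (f i)" "H (lift_pt 0 i) (lift_pt 1 i) = - v i" if i: "i \<in> S" for i
  proof -
    have e: "edge (double S) (lift_pt 0 i) (lift_pt 1 i)" "edge (double S) (lift_pt 1 i) (lift_pt 0 i)"
      using i by (simp_all add: edge_double_iff)
    have "v i \<in> ext_sub (sm i) \<and>\<^sub>s ext_sub (sp i)"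
      using netH e(1) unfolding koenigs_net_def v_def by fastforce
    moreover have "ext_sub (sm i) \<and>\<^sub>s ext_sub (sp i) \<subseteq> Lambda2 (f i)"
      unfolding Lambda2_def wedge_def using sub[OF i] by (intro span_mono) blast
    ultimately show "v i \<in> Lambda2 (f i)" by blast
    show "H (lift_pt 0 i) (lift_pt 1 i) = - v i"
      using netH e(2) unfolding koenigs_net_def one_form_def v_def by blast
  qed
  have skewm: "\<eta>m i j = - \<eta>m j i" if "edge S i j" for i j
    using netm edge_sym[OF that] unfolding koenigs_net_def one_form_def by blast
  have diff: "\<eta>m j i = \<eta>p j i + diff_form v j i" if e: "edge S i j" for i j
  proof -
    note ij = edge_in[OF e]
    have "H (lift_pt 0 i) (lift_pt 1 i) + H (lift_pt 1 i) (lift_pt 1 j) + H (lift_pt 1 j) (lift_pt 0 j)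
        + H (lift_pt 0 j) (lift_pt 0 i) = 0"
      using netH quad_double_vertical[OF e] unfolding koenigs_net_def closed_form_def by blast
    then have "- v i - \<eta>m j i + v j + \<eta>p j i = 0"
      using v ij skewm[OF e] by (simp add: H[OF e] H[OF edge_sym[OF e]] v_def[of j, symmetric])
    then show ?thesis by (simp add: diff_form_def algebra_simps)
  qed
  then show "\<eta>m \<in> form_class S f \<eta>p"
    using v unfolding form_class_def by blast
  have meet: "\<eta>p j i * ext_of e \<noteq> 0" and in_span: "\<eta>p j i \<in> Lambda2 (span (f i \<union> f j))"
    if edge: "edge S i j" and e: "e \<noteq> 0" "f i \<inter> f j = span {e}" for i j e
  proof -
    note ij = edge_in[OF edge]
    have lines: "sp i \<in> Grassmannian 1" "sm i \<in> Grassmannian 1" if "i \<in> S" for i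
      using netp netm that by (auto simp: koenigs_net_def regular_map_def)
    obtain x where x: "x \<noteq> 0" "sp i = span {x}" using Grassmannian_1_E[OF lines(1)] ij by metis
    obtain x' where x': "x' \<noteq> 0" "sm i = span {x'}" using Grassmannian_1_E[OF lines(2)] ij by metis
    obtain y where y: "y \<noteq> 0" "sp j = span {y}" using Grassmannian_1_E[OF lines(1)] ij by metis
    obtain y' where y': "y' \<noteq> 0" "sm j = span {y'}" using Grassmannian_1_E[OF lines(2)] ij by metis
    note gens = x(2) x'(2) y(2) y'(2) and ne = x(1) x'(1) y(1) y'(1)
    have mem: "x \<in> f i" "x' \<in> f i" "y \<in> f j" "y' \<in> f j"
    proof -
      have "x \<in> sp i" "x' \<in> sm i" "y \<in> sp j" "y' \<in> sm j" by (simp_all add: gens span_base)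
      then show "x \<in> f i" "x' \<in> f i" "y \<in> f j" "y' \<in> f j" using sub ij by blast+
    qed
    have distinct: "distinct [sp i, sp j, sm j, sm i]"
      using reg quad_double_vertical[OF edge] unfolding regular_map_def by fastforce
    have "\<eta>p j i \<in> span {ext_of y * ext_of x}" "\<eta>p j i \<noteq> 0"
      using netp edge unfolding koenigs_net_def by (simp_all flip: wedge_lines add: gens(1,3)[symmetric])
    then obtain c where c: "\<eta>p j i = c *\<^sub>R (ext_of y * ext_of x)" "c \<noteq> 0"
      by (auto simp: span_singleton)
    have "\<eta>m j i \<in> span {ext_of y' * ext_of x'}" "\<eta>m j i \<noteq> 0"
      using netm edge unfolding koenigs_net_def by (simp_all flip: wedge_lines add: gens(2,4)[symmetric])
    then obtain c' where c': "\<eta>m j i = c' *\<^sub>R (ext_of y' * ext_of x')" "c' \<noteq> 0"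
      by (auto simp: span_singleton)
    show "\<eta>p j i \<in> Lambda2 (span (f i \<union> f j))"
      using mem unfolding c(1) by (intro subspace_scale subspace_Lambda2 wedge_in_Lambda2) (auto intro: span_base)
    have mem_e: "e \<in> f i" "e \<in> f j" using e(2) span_base by blast+
    have same: "\<eta>p j i * ext_of e = \<eta>m j i * ext_of e"
      using Lambda2_plane_annihilated(2)[OF plane mem_e(1) v(1)]
        Lambda2_plane_annihilated(2)[OF plane mem_e(2) v(1)] ij
      by (simp add: diff[OF edge] diff_form_def distrib_right left_diff_distrib)
    have reorder: "ext_of b * (ext_of a * ext_of e) = - (ext_of e * (ext_of a * ext_of b))" for a b
      by (simp add: mult.assoc ext_of_anticommute[of a e] ext_of_left_anticommute[of b e] ext_of_anticommute[of b a])
    have transversal: "x \<notin> span {e} \<and> y \<notin> span {e}"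
    proof (rule ccontr)
      assume "\<not> ?thesis"
      then have xy: "x \<in> span {e} \<or> y \<in> span {e}" by blast
      then have eq: "sp i = span {e} \<or> sp j = span {e}"
        using span_singleton_eq ne gens by metis
      have "ext_of e * ext_of x * ext_of y = 0"
        using xy by (auto simp: span_singleton ext_simps ext_of_anticommute[of x e])
      then have "\<eta>p j i * ext_of e = 0" by (simp add: c mult.assoc reorder)
      then have "ext_of e * ext_of x' * ext_of y' = 0"
        using c' by (simp add: same mult.assoc reorder)
      moreover have "x' \<notin> span {e}" "y' \<notin> span {e}"
        using eq distinct span_singleton_eq ne gens by (metis distinct_length_2_or_more)+
      then have "ext_of e * ext_of x' * ext_of y' \<noteq> 0"
        using edge_frame(4)[OF edge e(2,1) mem(2) _ mem(4)] by blast
      ultimately show False by blast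
    qed
    then have "ext_of e * ext_of x * ext_of y \<noteq> 0"
      using edge_frame(4)[OF edge e(2,1) mem(1) _ mem(3)] by blast
    then show "\<eta>p j i * ext_of e \<noteq> 0" using c by (simp add: mult.assoc reorder)
  qed
  have "\<eta>p i j \<in> Lambda2 (span (f i \<union> f j)) \<and> {\<eta>p i j} \<and>\<^sub>s ext_sub (f i \<inter> f j) \<noteq> {0}"
    if "edge S i j" for i j
  proof -
    note edge = edge_sym[OF that]
    obtain e where e: "e \<noteq> 0" "f j \<inter> f i = span {e}" using edge_meet[OF edge] by metis
    show ?thesis
      using meet[OF edge e] in_span[OF edge e] e(2)
      by (simp add: Int_commute Un_commute wedge_singleton_line span_singleton_eq_0)
  qed
  then show "applicable_via S f \<eta>p"
    using netp regular unfolding applicable_via_def koenigs_net_def by blast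
qed

end

section \<open>The equivalence\<close>

theorem theorem3p23:
  fixes \<Sigma> :: "(int^'n) set" and f :: "int^'n \<Rightarrow> 'v::real_vector set"
  assumes fin_dim: "\<exists>B :: 'v set. finite B \<and> span B = UNIV"
    and "simply_connected_domain \<Sigma>"
    and "\<forall>i\<in>\<Sigma>. f i \<in> Grassmannian 2"
  shows "((regular_line_congruence \<Sigma> f \<and> (\<exists>\<eta>. applicable_via \<Sigma> f \<eta>)) \<longleftrightarrow>
      (regular_line_congruence \<Sigma> f \<and>
        (\<exists>sp \<eta>p sm \<eta>m. koenigs_moutard_pair \<Sigma> sp \<eta>p sm \<eta>m \<and> spanned_by \<Sigma> f sp sm)))
    \<and> (\<forall>\<eta>. regular_line_congruence \<Sigma> f \<and> applicable_via \<Sigma> f \<eta> \<longrightarrow>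
      (\<exists>sp \<eta>p sm \<eta>m. koenigs_moutard_pair \<Sigma> sp \<eta>p sm \<eta>m \<and> spanned_by \<Sigma> f sp sm \<and>
        \<eta>p \<in> form_class \<Sigma> f \<eta> \<and> \<eta>m \<in> form_class \<Sigma> f \<eta> \<and>
        form_class \<Sigma> f \<eta> = form_class \<Sigma> f \<eta>p \<and> form_class \<Sigma> f \<eta> = form_class \<Sigma> f \<eta>m))
    \<and> (\<forall>sp \<eta>p sm \<eta>m. regular_line_congruence \<Sigma> f \<and>
        koenigs_moutard_pair \<Sigma> sp \<eta>p sm \<eta>m \<and> spanned_by \<Sigma> f sp sm \<longrightarrow>
      form_class \<Sigma> f \<eta>p = form_class \<Sigma> f \<eta>m \<and>
      (\<forall>\<eta> \<in> form_class \<Sigma> f \<eta>p. applicable_via \<Sigma> f \<eta>))"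
proof -
  have forward: "\<exists>sp \<eta>p sm \<eta>m. koenigs_moutard_pair \<Sigma> sp \<eta>p sm \<eta>m \<and> spanned_by \<Sigma> f sp sm \<and>
      \<eta>p \<in> form_class \<Sigma> f \<eta> \<and> \<eta>m \<in> form_class \<Sigma> f \<eta> \<and>
      form_class \<Sigma> f \<eta> = form_class \<Sigma> f \<eta>p \<and> form_class \<Sigma> f \<eta> = form_class \<Sigma> f \<eta>m"
    if "applicable_via \<Sigma> f \<eta>" for \<eta>
  proof -
    interpret applicable_congruence \<Sigma> f \<eta> using that by unfold_locales
    obtain s \<tau> s' \<tau>' where sec: "koenigs_section s \<tau>" "koenigs_section s' \<tau>'"
      and ne: "\<And>i. i \<in> \<Sigma> \<Longrightarrow> s i \<noteq> s' i" "\<And>i. i \<in> \<Sigma> \<Longrightarrow> \<tau> i \<noteq> \<tau>' i"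
      using koenigs_sections_exist[OF assms(2)] by metis
    have "(\<lambda>j i. \<eta> j i + diff_form \<rho> j i) \<in> form_class \<Sigma> f \<eta>" if "koenigs_section t \<rho>" for t \<rho>
      using that unfolding form_class_def koenigs_section_def by blast
    then show ?thesis
      using koenigs_sections_moutard_pair[OF sec ne] sec form_class_eq by blast
  qed
  have backward: "form_class \<Sigma> f \<eta>p = form_class \<Sigma> f \<eta>m \<and>
      (\<forall>\<eta> \<in> form_class \<Sigma> f \<eta>p. applicable_via \<Sigma> f \<eta>)"
    if "regular_line_congruence \<Sigma> f" "koenigs_moutard_pair \<Sigma> sp \<eta>p sm \<eta>m" "spanned_by \<Sigma> f sp sm"
    for sp \<eta>p sm \<eta>m
  proof -
    interpret regular_congruence \<Sigma> f using that(1) by unfold_locales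
    show ?thesis
      using moutard_pair_applicable[OF that(2,3)] form_class_eq applicable_via_form_class by blast
  qed
  have "applicable_via \<Sigma> f \<eta>p"
    if "regular_line_congruence \<Sigma> f" "koenigs_moutard_pair \<Sigma> sp \<eta>p sm \<eta>m" "spanned_by \<Sigma> f sp sm"
    for sp \<eta>p sm \<eta>m
    using backward[OF that] form_class_refl by blast
  then have equivalence: "(\<exists>\<eta>. applicable_via \<Sigma> f \<eta>) \<longleftrightarrow>
      (\<exists>sp \<eta>p sm \<eta>m. koenigs_moutard_pair \<Sigma> sp \<eta>p sm \<eta>m \<and> spanned_by \<Sigma> f sp sm)"
    if "regular_line_congruence \<Sigma> f"
    using forward that by meson
  show ?thesis
  proof (intro conjI)
    show "(regular_line_congruence \<Sigma> f \<and> (\<exists>\<eta>. applicable_via \<Sigma> f \<eta>)) \<longleftrightarrow>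
      (regular_line_congruence \<Sigma> f \<and>
        (\<exists>sp \<eta>p sm \<eta>m. koenigs_moutard_pair \<Sigma> sp \<eta>p sm \<eta>m \<and> spanned_by \<Sigma> f sp sm))"
      by (rule conj_cong[OF refl equivalence])
  qed (intro allI impI, elim conjE, rule forward backward, assumption+)+
qed

end
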